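(* Let $\kappa$ be a nonnegative integer, let $w \in \mathbf{N}_\kappa$, and let $x_0 \in \mathbb{R}$. Then the following statements are equivalent: 1. $\liminf_{z \to x_0} |w(z)| < \infty$ and $-\infty < d := \liminf_{z \to x_0} K_w(z,z) < \infty$. 2. The nontangential limits $w_0 := \lim_{z \to x_0} w(z)$ and $\tilde d := \lim_{z \to x_0} K_w(z,z)$ exist and are real. 3. The nontangential limits $w_0 := \lim_{z \to x_0} w(z)$ and $w_1 := \lim_{z \to x_0} w'(z)$ exist and are real. 4. The nontangential limits $w_0 := \lim_{z \to x_0} w(z)$ and $\tilde w_1 := \lim_{z \to x_0} \frac{w(z)-w_0}{z-x_0}$ exist and are real. In this case, $d = \tilde d = w_1 = \tilde w_1$.
   Context: $\mathbb{C}^+$ is the open upper half plane. For a function $w$ meromorphic on $\mathbb{C}^+$, $\rho(w) \subset \mathbb{C}^+$ denotes its domain of analyticity, and $K_w(z,\zeta) = \frac{w(z)-\overline{w(\zeta)}}{z-\bar\zeta}$ for $z,\zeta \in \rho(w)$. The generalized Nevanlinna class $\mathbf{N}_\kappa$ is the set of functions $w$ meromorphic on $\mathbb{C}^+$ such that $K_w$ has $\kappa$ negative squares on $\rho(w)\times\rho(w)$: for every $m$ and $z_1,\dots,z_m \in \rho(w)$ the Hermitian matrix $[K_w(z_j,z_i)]_{i,j=1}^m$ has at most $\kappa$ negative eigenvalues, and for some choice of $m$ and points it has exactly $\kappa$. Nontangential limits are taken with $z \to x_0$ staying in a nontangential neighborhood of $x_0$ in $\mathbb{C}^+$; the limits inferior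 are taken with $z \to x_0$ unrestrictedly in $\rho(w) \subset \mathbb{C}^+$. *)

theory Defs
  imports "HOL-Complex_Analysis.Complex_Analysis" "Jordan_Normal_Form.Char_Poly"
begin

definition upper_half_plane :: "complex set" where
  "upper_half_plane = {z. Im z > 0}"

definition analyticity_domain :: "(complex \<Rightarrow> complex) \<Rightarrow> complex set" where
  "analyticity_domain w = {z \<in> upper_half_plane. w analytic_on {z}}"

definition nevanlinna_kernel :: "(complex \<Rightarrow> complex) \<Rightarrow> complex \<Rightarrow> complex \<Rightarrow> complex" where
  "nevanlinna_kernel w z \<zeta> = (w z - cnj (w \<zeta>)) / (z - cnj \<zeta>)"

definition pick_matrix :: "(complex \<Rightarrow> complex) \<Rightarrow> complex list \<Rightarrow> complex mat" where
  "pick_matrix w zs = Matrix.mat (length zs) (length zs)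
     (\<lambda>(i, j). nevanlinna_kernel w (zs ! j) (zs ! i))"

text \<open>Eigenvalues are counted with algebraic multiplicity, which for the Hermitian matrices
  considered here coincides with the geometric one.\<close>

definition num_neg_eigenvalues :: "complex mat \<Rightarrow> nat" where
  "num_neg_eigenvalues A =
     (\<Sum>\<mu> | \<mu> < 0 \<and> eigenvalue A (complex_of_real \<mu>).
        order (complex_of_real \<mu>) (char_poly A))"

text \<open>The predicate \<open>nicely_meromorphic_on\<close> selects the canonical representative of a meromorphic
  function: removable singularities are filled in, and the (irrelevant) value at a pole is \<open>0\<close>.
  The empty list of points is harmless: it contributes no negative eigenvalue, and
  the analyticity domain is never empty.\<close>

definition generalized_nevanlinna :: "nat \<Rightarrow> (complex \<Rightarrow> complex) set" where
  "generalized_nevanlinna \<kappa> = {w. w nicely_meromorphic_on upper_half_plane \<and>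
     (\<forall>zs. set zs \<subseteq> analyticity_domain w \<longrightarrow> num_neg_eigenvalues (pick_matrix w zs) \<le> \<kappa>) \<and>
     (\<exists>zs. set zs \<subseteq> analyticity_domain w \<and> num_neg_eigenvalues (pick_matrix w zs) = \<kappa>)}"

definition nontangential_sector :: "real \<Rightarrow> real \<Rightarrow> complex set" where
  "nontangential_sector x0 a = {z \<in> upper_half_plane. \<bar>Re z - x0\<bar> < a * Im z}"

text \<open>The real limit of \<open>f z\<close> as \<open>z\<close> tends to \<open>x0\<close> through the points of analyticity of \<open>w\<close>
  in each sector at \<open>x0\<close>, whatever its aperture.\<close>

definition nt_limit :: "(complex \<Rightarrow> complex) \<Rightarrow> real \<Rightarrow> (complex \<Rightarrow> complex) \<Rightarrow> real \<Rightarrow> bool" where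
  "nt_limit w x0 f L \<longleftrightarrow>
     (\<forall>a>0. (f \<longlongrightarrow> complex_of_real L)
        (at (complex_of_real x0) within (analyticity_domain w \<inter> nontangential_sector x0 a)))"

text \<open>The diagonal values of the kernel are real, so \<open>Re\<close> merely changes the type.\<close>

definition kernel_liminf :: "(complex \<Rightarrow> complex) \<Rightarrow> real \<Rightarrow> ereal" where
  "kernel_liminf w x0 = Liminf (at (complex_of_real x0) within analyticity_domain w)
     (\<lambda>z. ereal (Re (nevanlinna_kernel w z z)))"

definition modulus_liminf :: "(complex \<Rightarrow> complex) \<Rightarrow> real \<Rightarrow> ereal" where
  "modulus_liminf w x0 = Liminf (at (complex_of_real x0) within analyticity_domain w)
     (\<lambda>z. ereal (cmod (w z)))"

end

(* A Pick matrix with kappa negative eigenvalues, bordered by one more point z,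
   still has only kappa of them; testing it against the kappa negative directions gives
   Im w >= - C y (1 + |w|^2) on the whole domain of analyticity, with y = Im z.

   Near x0 everything then rests on the Schwarz-Pick inequality in half discs centred at x0.
   If d = liminf K_w is finite, then w - (d - e) z has nonnegative imaginary part near x0, and
   Schwarz-Pick along a sequence realizing the lower limit bounds its difference quotient at x0
   by a multiple of e in every sector, so that the difference quotient of w tends to d.
   Conversely, if w and K_w have nontangential limits, Schwarz-Pick for a multiple of the Cayley
   transform of w shows that w stays bounded at the points near x0 with Im w <= 0, so that K_w is
   bounded below.  The nontangential limits of the difference quotient, of w' and of K_w are
   related by the mean value inequality and by Cauchy's estimate. *)

theory Submission
  imports Defs "Jordan_Normal_Form.Schur_Decomposition"
begin

section \<open>Hermitian matrices and their negative eigenvalues\<close>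

text \<open>Three obstacles shape the argument. Positivity of the imaginary part is available only
  near \<open>x0\<close>, so the half plane of the classical Julia-Caratheodory argument is replaced
  by half discs, where the Blaschke factor is still explicit; between points of the concentric half
  disc of half the radius this costs a constant factor 4. The loss is harmless because the tested
  function is w(z) - (d - e) z: its kernel has lower limit e, so any constant times e is good
  enough. Poles may a priori accumulate at \<open>x0\<close>. The Schwarz-Pick estimates are
  therefore made for a Cayley transform, in which a pole becomes a regular point with value 1, the
  image of infinity. Finally, the lower bound obtained from the Pick matrices degenerates where |w|
  is large. In the converse direction an exponential factor makes the Cayley transform contractive
  again at the price of a change of order Im z, and the boundary value of the transform at
  \<open>x0\<close>, as the image of a finite \<open>w0\<close>, has positive distance from
  1.\<close>

lemma mat_adjoint_carrier:
  assumes "A \<in> carrier_mat n m"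
  shows "mat_adjoint A \<in> carrier_mat m n"
  using assms unfolding mat_adjoint_def by (auto simp: mat_of_rows_def)

lemma index_mat_adjoint:
  assumes "A \<in> carrier_mat n m" "i < m" "j < n"
  shows "mat_adjoint A $$ (i, j) = conjugate (A $$ (j, i))"
  using assms unfolding mat_adjoint_def by (auto simp: mat_of_rows_def)

lemma mat_mult_index_sum:
  assumes "A \<in> carrier_mat n m" "B \<in> carrier_mat m l" "i < n" "j < l"
  shows "(A * B) $$ (i, j) = (\<Sum>k<m. A $$ (i, k) * B $$ (k, j))"
  using assms by (auto simp: scalar_prod_def atLeast0LessThan)

lemma mat_adjoint_mult:
  fixes A B :: "complex mat"
  assumes "A \<in> carrier_mat n m" "B \<in> carrier_mat m l"
  shows "mat_adjoint (A * B) = mat_adjoint B * mat_adjoint A"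
proof (rule eq_matI)
  note C = mat_adjoint_carrier[OF assms(1)] mat_adjoint_carrier[OF assms(2)]
    mat_adjoint_carrier[OF mult_carrier_mat[OF assms]]
  show "dim_row (mat_adjoint (A * B)) = dim_row (mat_adjoint B * mat_adjoint A)"
    "dim_col (mat_adjoint (A * B)) = dim_col (mat_adjoint B * mat_adjoint A)"
    using C by auto
  fix i j assume "i < dim_row (mat_adjoint B * mat_adjoint A)" "j < dim_col (mat_adjoint B * mat_adjoint A)"
  then have ij: "i < l" "j < n" using C by auto
  show "mat_adjoint (A * B) $$ (i, j) = (mat_adjoint B * mat_adjoint A) $$ (i, j)"
    using ij assms C
    by (simp add: index_mat_adjoint[OF mult_carrier_mat[OF assms]] mat_mult_index_sum[OF assms]
        mat_mult_index_sum[OF C(2) C(1)] index_mat_adjoint[OF assms(1)] index_mat_adjoint[OF assms(2)]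
        mult.commute cnj_sum del: index_mult_mat)
qed

lemma mat_adjoint_adjoint:
  fixes A :: "complex mat"
  assumes "A \<in> carrier_mat n m"
  shows "mat_adjoint (mat_adjoint A) = A"
proof (rule eq_matI)
  note C = mat_adjoint_carrier[OF assms] mat_adjoint_carrier[OF mat_adjoint_carrier[OF assms]]
  show "dim_row (mat_adjoint (mat_adjoint A)) = dim_row A"
    "dim_col (mat_adjoint (mat_adjoint A)) = dim_col A"
    using C assms by auto
  fix i j assume "i < dim_row A" "j < dim_col A"
  then have "i < n" "j < m" using assms by auto
  then show "mat_adjoint (mat_adjoint A) $$ (i, j) = A $$ (i, j)"
    by (simp add: index_mat_adjoint[OF C(1)] index_mat_adjoint[OF assms])
qed

text \<open>Gram-Schmidt on a basis that starts with \<open>v\<close> keeps \<open>v\<close> and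
  makes the vectors orthogonal. Dividing each by its length \<open>s i\<close> makes the columns
  orthonormal; this is why the first column is only a multiple of \<open>v\<close>, which is enough
  for splitting off an eigenvector.\<close>

lemma unitary_completion:
  fixes v :: "complex vec"
  assumes v: "v \<in> carrier_vec n" and v0: "v \<noteq> 0\<^sub>v n" and n: "n > 0"
  obtains W c where "W \<in> carrier_mat n n" "mat_adjoint W * W = 1\<^sub>m n" "Matrix.col W 0 = c \<cdot>\<^sub>v v"
proof -
  interpret cof_vec_space n "TYPE(complex)" .
  define b where "b = basis_completion v"
  note bc = basis_completion[OF v v0, folded b_def]
  define ws where "ws = gram_schmidt n b"
  have b_set: "set b \<subseteq> carrier_vec n" and dist: "distinct b" and ind: "\<not> lin_dep (set b)"
    and len_b: "length b = n" and hd_b: "hd b = v"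
    using bc by auto
  obtain vs where bv: "b = v # vs" using hd_b len_b n by (cases b) auto
  have ws: "set ws \<subseteq> carrier_vec n" "corthogonal ws" "length ws = n"
    using gram_schmidt_result[OF b_set dist ind refl, folded ws_def] len_b by auto
  have ws0: "ws ! 0 = v"
    using gram_schmidt_hd[OF v, of vs, folded bv, folded ws_def] ws n
    by (metis hd_conv_nth length_0_conv less_numeral_extra(3))
  have wsc: "ws ! i \<in> carrier_vec n" if "i < n" for i using ws that by auto
  define s where "s i = sqrt (\<Sum>k<n. (cmod (vec_index (ws ! i) k))\<^sup>2)" for i
  have sq: "(ws ! i) \<bullet>c (ws ! i) = complex_of_real ((s i)\<^sup>2)" if "i < n" for i
  proof -
    have "(ws ! i) \<bullet>c (ws ! i) = (\<Sum>k<n. vec_index (ws ! i) k * cnj (vec_index (ws ! i) k))"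
      using wsc[OF that] by (simp add: scalar_prod_def atLeast0LessThan)
    also have "\<dots> = complex_of_real (\<Sum>k<n. (cmod (vec_index (ws ! i) k))\<^sup>2)"
      unfolding of_real_sum by (intro sum.cong refl) (simp only: complex_norm_square)
    finally show ?thesis by (simp add: s_def sum_nonneg)
  qed
  have s0: "s i \<noteq> 0" if "i < n" for i
    using sq[OF that] corthogonalD[OF ws(2), of i i] that ws(3) by auto
  define W where "W = Matrix.mat n n (\<lambda>(k, i). vec_index (ws ! i) k / complex_of_real (s i))"
  have W: "W \<in> carrier_mat n n" by (simp add: W_def)
  have "mat_adjoint W * W = 1\<^sub>m n"
  proof (rule eq_matI)
    show "dim_row (mat_adjoint W * W) = dim_row (1\<^sub>m n)" "dim_col (mat_adjoint W * W) = dim_col (1\<^sub>m n)"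
      using W mat_adjoint_carrier[OF W] by auto
    fix i j assume "i < dim_row (1\<^sub>m n)" "j < dim_col (1\<^sub>m n)"
    then have ij: "i < n" "j < n" by auto
    have "(mat_adjoint W * W) $$ (i, j) = (\<Sum>k<n. cnj (W $$ (k, i)) * W $$ (k, j))"
      using ij by (simp add: mat_mult_index_sum[OF mat_adjoint_carrier[OF W] W]
          index_mat_adjoint[OF W] del: index_mult_mat)
    also have "\<dots> = (\<Sum>k<n. vec_index (ws ! j) k * cnj (vec_index (ws ! i) k)) / (of_real (s i) * of_real (s j))"
      using ij by (simp add: W_def sum_divide_distrib mult.commute)
    also have "(\<Sum>k<n. vec_index (ws ! j) k * cnj (vec_index (ws ! i) k)) = (ws ! j) \<bullet>c (ws ! i)"
      using carrier_vecD[OF wsc[OF ij(1)]] by (simp add: scalar_prod_def atLeast0LessThan)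
    also have "\<dots> / (of_real (s i) * of_real (s j)) = (if i = j then 1 else 0)"
      using sq[OF ij(1)] s0[OF ij(1)] corthogonalD[OF ws(2), of j i] ij ws(3)
      by (auto simp: power2_eq_square)
    finally show "(mat_adjoint W * W) $$ (i, j) = 1\<^sub>m n $$ (i, j)" using ij by simp
  qed
  moreover have "Matrix.col W 0 = (1 / complex_of_real (s 0)) \<cdot>\<^sub>v v"
    using n v ws0 by (intro eq_vecI) (auto simp: W_def)
  ultimately show ?thesis using W that by blast
qed

definition real_diag :: "nat \<Rightarrow> (nat \<Rightarrow> real) \<Rightarrow> complex mat" where
  "real_diag n d = Matrix.mat n n (\<lambda>(i, j). if i = j then complex_of_real (d i) else 0)"

lemma real_diag_carrier [simp]: "real_diag n d \<in> carrier_mat n n"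
  by (simp add: real_diag_def)

lemma index_unitary_diag:
  assumes U: "U \<in> carrier_mat n n" and ij: "i < n" "j < n"
  shows "(U * real_diag n d * mat_adjoint U) $$ (i, j) =
    (\<Sum>k<n. of_real (d k) * U $$ (i, k) * cnj (U $$ (j, k)))"
proof -
  have UD: "U * real_diag n d \<in> carrier_mat n n" using U by auto
  have 1: "(U * real_diag n d) $$ (i, k) = U $$ (i, k) * of_real (d k)" if "k < n" for k
  proof -
    have "(U * real_diag n d) $$ (i, k) = (\<Sum>l<n. U $$ (i, l) * real_diag n d $$ (l, k))"
      using mat_mult_index_sum[OF U real_diag_carrier ij(1) that] .
    also have "\<dots> = (\<Sum>l<n. if l = k then U $$ (i, l) * of_real (d l) else 0)"
      using that by (intro sum.cong) (auto simp: real_diag_def)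
    also have "\<dots> = U $$ (i, k) * of_real (d k)"
      using that by (subst sum.delta) auto
    finally show ?thesis .
  qed
  show ?thesis
    unfolding mat_mult_index_sum[OF UD mat_adjoint_carrier[OF U] ij]
    using ij by (intro sum.cong) (simp_all add: 1 index_mat_adjoint[OF U] mult_ac del: index_mult_mat)
qed

text \<open>Deflation: an eigenvector, supplied by the fundamental theorem of algebra, is completed
  to a unitary \<open>W\<close>; conjugation by \<open>W\<close> splits off a 1 x 1 block, and the
  induction hypothesis treats the Hermitian block that remains.\<close>

theorem hermitian_diagonalization:
  fixes A :: "complex mat"
  assumes "A \<in> carrier_mat n n" "mat_adjoint A = A"
  shows "\<exists>U d. U \<in> carrier_mat n n \<and> mat_adjoint U * U = 1\<^sub>m n \<and> A = U * real_diag n d * mat_adjoint U"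
  using assms
proof (induction n arbitrary: A)
  case 0
  then have "1\<^sub>m 0 \<in> carrier_mat 0 0 \<and> mat_adjoint (1\<^sub>m 0) * 1\<^sub>m 0 = (1\<^sub>m 0 :: complex mat) \<and>
      A = 1\<^sub>m 0 * real_diag 0 (\<lambda>_. 0) * mat_adjoint (1\<^sub>m 0)"
    by (intro conjI eq_matI) (auto simp: mat_adjoint_def)
  then show ?case by blast
next
  case (Suc m A)
  let ?n = "Suc m"
  note A = Suc.prems(1)
  have "degree (char_poly A) = ?n" using degree_monic_char_poly[OF A] by simp
  then obtain e where "poly (char_poly A) e = 0"
    using fundamental_theorem_of_algebra[of "char_poly A"] by (auto simp: constant_degree)
  then have "eigenvalue A e" using eigenvalue_root_char_poly[OF A] by simp
  then obtain v where v: "v \<in> carrier_vec ?n" "v \<noteq> 0\<^sub>v ?n" and Av: "A *\<^sub>v v = e \<cdot>\<^sub>v v"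
    using A unfolding eigenvalue_def eigenvector_def by auto
  obtain W c where W: "W \<in> carrier_mat ?n ?n" and WW: "mat_adjoint W * W = 1\<^sub>m ?n"
    and col: "Matrix.col W 0 = c \<cdot>\<^sub>v v"
    using unitary_completion[OF v] by auto
  have W': "mat_adjoint W \<in> carrier_mat ?n ?n" using mat_adjoint_carrier[OF W] .
  have WW': "W * mat_adjoint W = 1\<^sub>m ?n" using mat_mult_left_right_inverse[OF W' W WW] .
  define B where "B = mat_adjoint W * (A * W)"
  have AW: "A * W \<in> carrier_mat ?n ?n" using A W by auto
  have B: "B \<in> carrier_mat ?n ?n" using W' AW by (auto simp: B_def)
  have Bh: "mat_adjoint B = B"
    using Suc.prems(2) W W' A AW
    by (simp add: B_def mat_adjoint_mult[OF W' AW] mat_adjoint_mult[OF A W] mat_adjoint_adjoint[OF W]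
        assoc_mult_mat[OF W' A W])
  have AWB: "A = W * B * mat_adjoint W"
  proof -
    have "W * B = A * W"
      unfolding B_def by (metis assoc_mult_mat[OF W W' AW] WW' left_mult_one_mat[OF AW])
    then show ?thesis using assoc_mult_mat[OF A W W'] WW' A by simp
  qed
  have Bherm: "B $$ (j, i) = cnj (B $$ (i, j))" if "i < ?n" "j < ?n" for i j
    using index_mat_adjoint[OF B that(2) that(1)] Bh by simp
  have colAW: "(A * W) $$ (k, 0) = e * W $$ (k, 0)" if "k < ?n" for k
  proof -
    have "(A * W) $$ (k, 0) = vec_index (Matrix.col (A * W) 0) k" using that A W by simp
    also have "Matrix.col (A * W) 0 = A *\<^sub>v Matrix.col W 0" using A W by (intro col_mult2) auto
    also have "\<dots> = e \<cdot>\<^sub>v Matrix.col W 0"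
      unfolding col using A v Av by (simp add: mult_mat_vec smult_smult_assoc mult.commute)
    finally show ?thesis using that W by simp
  qed
  have col0: "B $$ (i, 0) = (if i = 0 then e else 0)" if i: "i < ?n" for i
  proof -
    have "B $$ (i, 0) = (\<Sum>k<?n. mat_adjoint W $$ (i, k) * (A * W) $$ (k, 0))"
      unfolding B_def using mat_mult_index_sum[OF W' AW i] by simp
    also have "\<dots> = (\<Sum>k<?n. e * (mat_adjoint W $$ (i, k) * W $$ (k, 0)))"
      by (intro sum.cong) (auto simp: colAW simp del: index_mult_mat)
    also have "\<dots> = e * (mat_adjoint W * W) $$ (i, 0)"
      by (simp only: mat_mult_index_sum[OF W' W i zero_less_Suc] sum_distrib_left)
    finally show ?thesis using i by (simp add: WW)
  qed
  \<comment> \<open>The eigenvector fixes the first column of \<open>B\<close>; Hermitian symmetry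
    transfers its zeros to the first row, so that \<open>B\<close> is block diagonal.\<close>
  have row0: "B $$ (0, i) = (if i = 0 then e else 0)" if "i < ?n" for i
    using col0[OF that] Bherm[of 0 0] Bherm[of i 0] col0[of 0] that by (auto split: if_splits)
  have e_real: "e = of_real (Re e)"
    using Bherm[of 0 0] col0[of 0] by (simp add: complex_eq_iff)
  define C where "C = Matrix.mat m m (\<lambda>(i, j). B $$ (Suc i, Suc j))"
  have C: "C \<in> carrier_mat m m" by (simp add: C_def)
  have C_entry: "C $$ (i, j) = B $$ (Suc i, Suc j)" if "i < m" "j < m" for i j
    using that by (simp add: C_def)
  have "mat_adjoint C = C"
    using mat_adjoint_carrier[OF C] C
    by (intro eq_matI) (auto simp: index_mat_adjoint[OF C] C_entry Bherm[symmetric])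
  from Suc.IH[OF C this] obtain U d where U: "U \<in> carrier_mat m m"
    and UU: "mat_adjoint U * U = 1\<^sub>m m" and CU: "C = U * real_diag m d * mat_adjoint U" by blast
  \<comment> \<open>\<open>V\<close> is the block sum of 1 and \<open>U\<close>, and
    \<open>d'\<close> puts the split-off eigenvalue, real by \<open>e_real\<close>, in front of
    \<open>d\<close>.\<close>
  define V where "V = Matrix.mat ?n ?n (\<lambda>(i, j). if i = 0 \<and> j = 0 then 1 else
      if i = 0 \<or> j = 0 then 0 else U $$ (i - 1, j - 1))"
  define d' where "d' i = (if i = 0 then Re e else d (i - 1))" for i
  have V: "V \<in> carrier_mat ?n ?n" by (simp add: V_def)
  have V': "mat_adjoint V \<in> carrier_mat ?n ?n" using mat_adjoint_carrier[OF V] .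
  have VV: "mat_adjoint V * V = 1\<^sub>m ?n"
  proof (rule eq_matI)
    show "dim_row (mat_adjoint V * V) = dim_row (1\<^sub>m ?n)" "dim_col (mat_adjoint V * V) = dim_col (1\<^sub>m ?n)"
      using V V' by auto
    fix i j assume "i < dim_row (1\<^sub>m ?n)" "j < dim_col (1\<^sub>m ?n)"
    then have ij: "i < ?n" "j < ?n" by auto
    have eq: "(mat_adjoint V * V) $$ (i, j) = (\<Sum>k<?n. cnj (V $$ (k, i)) * V $$ (k, j))"
      using ij by (simp add: mat_mult_index_sum[OF V' V] index_mat_adjoint[OF V]
          del: index_mult_mat sum.lessThan_Suc)
    have UUe: "(\<Sum>k<m. cnj (U $$ (k, i')) * U $$ (k, j')) = (if i' = j' then 1 else 0)"
      if "i' < m" "j' < m" for i' j'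
      using mat_mult_index_sum[OF mat_adjoint_carrier[OF U] U that] that
      by (simp add: UU index_mat_adjoint[OF U])
    show "(mat_adjoint V * V) $$ (i, j) = 1\<^sub>m ?n $$ (i, j)"
      unfolding eq sum.lessThan_Suc_shift using ij
      by (cases i; cases j) (auto simp: V_def UUe)
  qed
  have BV: "B = V * real_diag ?n d' * mat_adjoint V"
  proof (rule eq_matI)
    show "dim_row B = dim_row (V * real_diag ?n d' * mat_adjoint V)"
      "dim_col B = dim_col (V * real_diag ?n d' * mat_adjoint V)" using B V V' by auto
    fix i j assume "i < dim_row (V * real_diag ?n d' * mat_adjoint V)"
      "j < dim_col (V * real_diag ?n d' * mat_adjoint V)"
    then have ij: "i < ?n" "j < ?n" using V V' by auto
    have Ce: "(\<Sum>k<m. of_real (d k) * U $$ (i', k) * cnj (U $$ (j', k))) = B $$ (Suc i', Suc j')"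
      if "i' < m" "j' < m" for i' j'
      using index_unitary_diag[OF U that, of d] C_entry[OF that] unfolding CU[symmetric] by simp
    show "B $$ (i, j) = (V * real_diag ?n d' * mat_adjoint V) $$ (i, j)"
      unfolding index_unitary_diag[OF V ij] sum.lessThan_Suc_shift
      using ij e_real by (cases i; cases j) (auto simp: V_def d'_def row0 col0 Ce)
  qed
  let ?D = "real_diag ?n d'"
  have WV: "W * V \<in> carrier_mat ?n ?n" using W V by auto
  have adj: "mat_adjoint (W * V) = mat_adjoint V * mat_adjoint W" using mat_adjoint_mult[OF W V] .
  have "mat_adjoint (W * V) * (W * V) = mat_adjoint V * (mat_adjoint W * W) * V"
    unfolding adj using W W' V V' by (simp add: assoc_mult_mat[of _ ?n ?n _ ?n _ ?n])
  also have "\<dots> = 1\<^sub>m ?n" using V' by (simp add: WW VV)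
  finally have "mat_adjoint (W * V) * (W * V) = 1\<^sub>m ?n" .
  moreover have "A = W * V * ?D * mat_adjoint (W * V)"
  proof -
    have D: "?D \<in> carrier_mat ?n ?n" by simp
    have VD: "V * ?D \<in> carrier_mat ?n ?n" using V D by (rule mult_carrier_mat)
    have WVD: "W * V * ?D \<in> carrier_mat ?n ?n" using WV D by (rule mult_carrier_mat)
    have "W * (V * ?D * mat_adjoint V) = W * V * ?D * mat_adjoint V"
      using assoc_mult_mat[OF W VD V'] assoc_mult_mat[OF W V D] by simp
    then show ?thesis
      unfolding adj AWB BV using assoc_mult_mat[OF WVD V' W'] by simp
  qed
  ultimately show ?case using WV by blast
qed

text \<open>Orders add over nonzero products, and a monic linear factor contributes 1 exactly at its
  root. For a characteristic polynomial this turns algebraic multiplicities into numbers of diagonal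
  entries.\<close>

lemma order_prod_linear:
  fixes c :: "nat \<Rightarrow> 'a :: idom"
  shows "Polynomial.order a (\<Prod>k<n. [:- c k, 1:]) = card {k. k < n \<and> c k = a}"
proof (induction n)
  case (Suc n)
  have "(\<Prod>k<n. [:- c k, 1:]) \<noteq> 0" by (simp add: prod_zero_iff)
  then have "(\<Prod>k<n. [:- c k, 1:]) * [:- c n, 1:] \<noteq> 0" by (simp only: mult_eq_0_iff) simp
  then have "Polynomial.order a (\<Prod>k<Suc n. [:- c k, 1:]) = card {k. k < n \<and> c k = a} + Polynomial.order a [:- c n, 1:]"
    by (simp only: prod.lessThan_Suc order_mult[OF \<open>_ * _ \<noteq> 0\<close>] Suc)
  moreover have "Polynomial.order a [:- c n, 1:] = (if c n = a then 1 else 0)"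
    using order_power_n_n[of a 1] by (auto simp: order_0I)
  moreover have "{k. k < Suc n \<and> c k = a} =
      (if c n = a then insert n {k. k < n \<and> c k = a} else {k. k < n \<and> c k = a})"
    by (auto simp: less_Suc_eq)
  ultimately show ?case by simp
qed simp

text \<open>The spectral theorem in coordinates, \<open>u k i\<close> being the i-th coordinate of
  the k-th eigenvector. Similarity preserves the characteristic polynomial, so the multiplicities
  counted by \<open>num_neg_eigenvalues\<close> can be read off the diagonal.\<close>

lemma hermitian_eigenbasis:
  fixes A :: "complex mat"
  assumes A: "A \<in> carrier_mat n n" and h: "\<forall>i<n. \<forall>j<n. A $$ (j, i) = cnj (A $$ (i, j))"
  shows "\<exists>u d. (\<forall>k<n. \<forall>l<n. (\<Sum>i<n. cnj (u k i) * u l i) = (if k = l then 1 else 0)) \<and>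
    (\<forall>i<n. \<forall>j<n. A $$ (i, j) = (\<Sum>k<n. of_real (d k) * u k i * cnj (u k j))) \<and>
    num_neg_eigenvalues A = card {k. k < n \<and> (d k :: real) < 0}"
proof -
  have "mat_adjoint A = A"
    using mat_adjoint_carrier[OF A] A
    by (intro eq_matI) (auto simp: index_mat_adjoint[OF A] h[rule_format, symmetric])
  from hermitian_diagonalization[OF A this] obtain U d where U: "U \<in> carrier_mat n n"
    and UU: "mat_adjoint U * U = 1\<^sub>m n" and AU: "A = U * real_diag n d * mat_adjoint U" by blast
  note U' = mat_adjoint_carrier[OF U]
  define u where "u k i = U $$ (i, k)" for k i
  have 1: "(\<Sum>i<n. cnj (u k i) * u l i) = (if k = l then 1 else 0)" if "k < n" "l < n" for k l
    using mat_mult_index_sum[OF U' U that] that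
    by (simp add: UU index_mat_adjoint[OF U] u_def)
  have 2: "A $$ (i, j) = (\<Sum>k<n. of_real (d k) * u k i * cnj (u k j))" if "i < n" "j < n" for i j
    using index_unitary_diag[OF U that, of d] AU by (simp add: u_def)
  have "similar_mat_wit A (real_diag n d) U (mat_adjoint U)"
    using mat_mult_left_right_inverse[OF U' U UU] UU AU A U U'
    by (intro similar_mat_witI[of _ _ n]) auto
  then have "char_poly A = char_poly (real_diag n d)"
    by (intro char_poly_similar) (auto simp: similar_mat_def)
  also have "\<dots> = (\<Prod>a\<leftarrow>diag_mat (real_diag n d). [:- a, 1:])"
    by (intro char_poly_upper_triangular[of _ n]) (auto simp: real_diag_def)
  also have "diag_mat (real_diag n d) = map (\<lambda>k. complex_of_real (d k)) [0..<n]"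
    by (auto simp: diag_mat_def real_diag_def)
  also have "(\<Prod>a\<leftarrow>map (\<lambda>k. complex_of_real (d k)) [0..<n]. [:- a, 1:]) = (\<Prod>k<n. [:- complex_of_real (d k), 1:])"
    using prod.distinct_set_conv_list[of "[0..<n]" "\<lambda>k. [:- complex_of_real (d k), 1:]"]
    by (simp add: atLeast0LessThan comp_def)
  finally have cp: "char_poly A = (\<Prod>k<n. [:- complex_of_real (d k), 1:])" .
  have ord: "Polynomial.order (complex_of_real \<mu>) (char_poly A) = card {k. k < n \<and> d k = \<mu>}" for \<mu>
    unfolding cp order_prod_linear by simp
  have ev: "eigenvalue A (complex_of_real \<mu>) \<longleftrightarrow> (\<exists>k<n. d k = \<mu>)" for \<mu>
    by (auto simp: eigenvalue_root_char_poly[OF A] cp poly_prod)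
  \<comment> \<open>The sum over the distinct negative values runs over the fibres of
    \<open>d\<close>, which together make up the index set.\<close>
  have "num_neg_eigenvalues A = (\<Sum>\<mu>\<in>d ` {k. k < n \<and> d k < 0}. card {k. k < n \<and> d k = \<mu>})"
    unfolding num_neg_eigenvalues_def ord ev by (intro sum.cong) auto
  also have "\<dots> = (\<Sum>\<mu>\<in>d ` {k. k < n \<and> d k < 0}. card {k \<in> {k. k < n \<and> d k < 0}. d k = \<mu>})"
    by (intro sum.cong arg_cong[of _ _ card]) auto
  also have "\<dots> = card {k. k < n \<and> d k < 0}"
    using sum.image_gen[of "{k. k < n \<and> d k < 0}" "\<lambda>_. 1::nat" d] by simp
  finally have 3: "num_neg_eigenvalues A = card {k. k < n \<and> d k < 0}" .
  show ?thesis by (intro exI[of _ u] exI[of _ d] conjI allI impI 1 2 3)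
qed

text \<open>Gaussian elimination: a row with a nonzero entry \<open>M j p\<close> eliminates the
  unknown \<open>p\<close> from the other rows, which leaves one equation and one unknown fewer. A
  zero row is dropped.\<close>

lemma underdetermined_system:
  fixes M :: "'j \<Rightarrow> 'i \<Rightarrow> 'a :: field"
  assumes "finite J" "finite I" "card J < card I"
  shows "\<exists>c. (\<exists>i\<in>I. c i \<noteq> 0) \<and> (\<forall>j\<in>J. (\<Sum>i\<in>I. M j i * c i) = 0)"
  using assms
proof (induction J arbitrary: I M rule: finite_induct)
  case empty
  then show ?case by (intro exI[of _ "\<lambda>_. 1"]) (auto simp: card_gt_0_iff)
next
  case (insert j J)
  show ?case
  proof (cases "\<forall>i\<in>I. M j i = 0")
    case True
    have "card J < card I" using insert by simp
    from insert.IH[OF insert.prems(1) this, of M] True show ?thesis by auto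
  next
    case False
    then obtain p where p: "p \<in> I" "M j p \<noteq> 0" by auto
    define M' where "M' k i = M k i - M k p / M j p * M j i" for k i
    have "card J < card (I - {p})" using insert p by simp
    from insert.IH[OF _ this, of M'] insert.prems(1) obtain c0 where
      c0: "\<exists>i\<in>I - {p}. c0 i \<noteq> 0" "\<And>k. k \<in> J \<Longrightarrow> (\<Sum>i\<in>I - {p}. M' k i * c0 i) = 0" by auto
    define S where "S = (\<Sum>i\<in>I - {p}. M j i * c0 i)"
    \<comment> \<open>The value at the pivot \<open>p\<close> is the one that solves row
      \<open>j\<close>; with it, a solution of the reduced rows \<open>M'\<close> solves the
      original rows.\<close>
    define c where "c i = (if i = p then - S / M j p else c0 i)" for i
    have split: "(\<Sum>i\<in>I. M k i * c i) = - M k p * S / M j p + (\<Sum>i\<in>I - {p}. M k i * c0 i)" for k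
      using insert.prems(1) p by (simp add: sum.remove[of I p] c_def)
    have "(\<Sum>i\<in>I. M k i * c i) = 0" if "k \<in> J" for k
    proof -
      have "(\<Sum>i\<in>I - {p}. M' k i * c0 i) = (\<Sum>i\<in>I - {p}. M k i * c0 i) - M k p / M j p * S"
        by (simp add: M'_def S_def left_diff_distrib sum_subtractf sum_distrib_left mult.assoc)
      then show ?thesis using c0(2)[OF that] by (simp add: split)
    qed
    moreover have "(\<Sum>i\<in>I. M j i * c i) = 0" using p by (simp add: split S_def)
    moreover have "\<exists>i\<in>I. c i \<noteq> 0" using c0(1) by (auto simp: c_def)
    ultimately show ?thesis by blast
  qed
qed

lemma hermitian_form_eigenbasis:
  fixes x :: "nat \<Rightarrow> complex"
  shows "(\<Sum>i<n. \<Sum>j<n. cnj (x i) * (\<Sum>k<n. of_real (d k) * u k i * cnj (u k j)) * x j) =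
    of_real (\<Sum>k<n. d k * (cmod (\<Sum>i<n. cnj (u k i) * x i))\<^sup>2)"
proof -
  have "(\<Sum>i<n. \<Sum>j<n. cnj (x i) * (\<Sum>k<n. of_real (d k) * u k i * cnj (u k j)) * x j) =
      (\<Sum>i<n. \<Sum>j<n. \<Sum>k<n. of_real (d k) * ((cnj (x i) * u k i) * (cnj (u k j) * x j)))"
    by (simp add: sum_distrib_left sum_distrib_right mult_ac)
  also have "\<dots> = (\<Sum>i<n. \<Sum>k<n. \<Sum>j<n. of_real (d k) * ((cnj (x i) * u k i) * (cnj (u k j) * x j)))"
    by (intro sum.cong refl sum.swap)
  also have "\<dots> = (\<Sum>k<n. \<Sum>i<n. \<Sum>j<n. of_real (d k) * ((cnj (x i) * u k i) * (cnj (u k j) * x j)))"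
    by (rule sum.swap)
  also have "\<dots> = (\<Sum>k<n. of_real (d k) * ((\<Sum>i<n. cnj (x i) * u k i) * (\<Sum>j<n. cnj (u k j) * x j)))"
    by (simp only: sum_product) (simp only: sum_distrib_left)
  also have "\<dots> = (\<Sum>k<n. of_real (d k * (cmod (\<Sum>i<n. cnj (u k i) * x i))\<^sup>2))"
  proof (intro sum.cong refl)
    fix k
    have "(\<Sum>i<n. cnj (x i) * u k i) = cnj (\<Sum>i<n. cnj (u k i) * x i)" by (simp add: mult.commute)
    then show "of_real (d k) * ((\<Sum>i<n. cnj (x i) * u k i) * (\<Sum>j<n. cnj (u k j) * x j)) =
        complex_of_real (d k * (cmod (\<Sum>i<n. cnj (u k i) * x i))\<^sup>2)"
      by (simp only: of_real_mult complex_norm_square mult.commute)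
  qed
  finally show ?thesis by simp
qed

lemma weighted_am_gm:
  fixes a b e :: real
  assumes "e > 0"
  shows "2 * (a * b) \<le> e * a\<^sup>2 + b\<^sup>2 / e"
proof -
  have "e * a\<^sup>2 + b\<^sup>2 / e - 2 * (a * b) = (e * a - b)\<^sup>2 / e"
    using assms by (simp add: power2_diff power_mult_distrib diff_divide_distrib add_divide_distrib)
      (simp add: power2_eq_square)
  also have "\<dots> \<ge> 0" using assms by simp
  finally show ?thesis by simp
qed

text \<open>A vector orthogonal to the negative eigenvectors of \<open>A\<close> can be found in the span of the
  negative eigenvectors of \<open>P\<close> and the last unit vector, and evaluating the form at it bounds the
  corner entry.\<close>

lemma bordered_corner_lower_bound:
  fixes P :: "complex mat"
  assumes P: "P \<in> carrier_mat n n" and hP: "\<forall>i<n. \<forall>j<n. P $$ (j, i) = cnj (P $$ (i, j))"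
  shows "\<exists>C\<ge>0. \<forall>A. A \<in> carrier_mat (Suc n) (Suc n) \<and>
      (\<forall>i<Suc n. \<forall>j<Suc n. A $$ (j, i) = cnj (A $$ (i, j))) \<and>
      (\<forall>i<n. \<forall>j<n. A $$ (i, j) = P $$ (i, j)) \<and>
      num_neg_eigenvalues A \<le> num_neg_eigenvalues P \<longrightarrow>
      - C * (\<Sum>i<n. (cmod (A $$ (i, n)))\<^sup>2) \<le> Re (A $$ (n, n))"
proof -
  obtain u d where on': "\<forall>k<n. \<forall>l<n. (\<Sum>i<n. cnj (u k i) * u l i) = (if k = l then 1 else 0)"
    and Pe': "\<forall>i<n. \<forall>j<n. P $$ (i, j) = (\<Sum>k<n. of_real (d k) * u k i * cnj (u k j))"
    and nP: "num_neg_eigenvalues P = card {k. k < n \<and> d k < 0}"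
    using hermitian_eigenbasis[OF P hP] by blast
  note on = on'[rule_format] and Pe = Pe'[rule_format]
  define N where "N = {k. k < n \<and> d k < 0}"
  have N: "finite N" "\<And>k. k \<in> N \<Longrightarrow> k < n" by (auto simp: N_def)
  \<comment> \<open>All negative eigenvalues of \<open>P\<close> lie at or below
    \<open>- \<delta>\<close>. The inserted -1 keeps the maximum defined and negative when there are
    none.\<close>
  define \<delta> where "\<delta> = - Max (insert (-1) (d ` N))"
  have "Max (insert (-1) (d ` N)) < 0"
    using N(1) by (subst Max_less_iff) (auto simp: N_def)
  then have \<delta>: "\<delta> > 0" by (simp add: \<delta>_def)
  have d\<delta>: "d k \<le> - \<delta>" if "k \<in> N" for k
  proof -
    have "d k \<le> Max (insert (-1) (d ` N))" using N(1) that by (intro Max_ge) auto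
    then show ?thesis by (simp add: \<delta>_def)
  qed
  show ?thesis
  proof (intro exI[of _ "1 / \<delta>"] conjI allI impI; (elim conjE)?)
    show "1 / \<delta> \<ge> 0" using \<delta> by simp
    fix A :: "complex mat"
    assume A: "A \<in> carrier_mat (Suc n) (Suc n)"
      and hA: "\<forall>i<Suc n. \<forall>j<Suc n. A $$ (j, i) = cnj (A $$ (i, j))"
      and AP': "\<forall>i<n. \<forall>j<n. A $$ (i, j) = P $$ (i, j)"
      and le: "num_neg_eigenvalues A \<le> num_neg_eigenvalues P"
    note AP = AP'[rule_format]
    obtain u' d' where
        Ae': "\<forall>i<Suc n. \<forall>j<Suc n. A $$ (i, j) = (\<Sum>k<Suc n. of_real (d' k) * u' k i * cnj (u' k j))"
      and nA: "num_neg_eigenvalues A = card {k. k < Suc n \<and> d' k < 0}"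
      using hermitian_eigenbasis[OF A hA] by (elim exE conjE) (rule that)
    note Ae = Ae'[rule_format]
    define N' where "N' = {k. k < Suc n \<and> d' k < 0}"
    have nN: "n \<notin> N" by (simp add: N_def)
    have "card N' \<le> card N" using le unfolding nA nP N_def N'_def .
    then have card_less: "card N' < card (insert n N)" using N(1) nN by simp
    have fin: "finite N'" "finite (insert n N)" using N(1) by (simp_all add: N'_def)
    \<comment> \<open>Row \<open>l\<close> holds the inner products with the negative eigenvector
      \<open>u' l\<close> of \<open>A\<close>. The columns in \<open>N\<close> stand for the
      negative eigenvectors of \<open>P\<close> padded with a zero, and the index \<open>n\<close>,
      which is not in \<open>N\<close>, labels the last unit vector. By \<open>card_less\<close>
      there are more unknowns than equations.\<close>
    define M where "M l k = (if k = n then cnj (u' l n) else (\<Sum>i<n. cnj (u' l i) * u k i))" for l k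
    obtain c where c0: "\<exists>i\<in>insert n N. c i \<noteq> 0"
      and c: "\<forall>l\<in>N'. (\<Sum>k\<in>insert n N. M l k * c k) = 0"
      using underdetermined_system[OF fin card_less, of M] by (elim exE conjE) (rule that)
    define x where "x i = (if i = n then c n else (\<Sum>k\<in>N. c k * u k i))" for i
    define s where "s = (\<Sum>k\<in>N. (cmod (c k))\<^sup>2)"
    have orth: "(\<Sum>i<Suc n. cnj (u' l i) * x i) = 0" if "l \<in> N'" for l
    proof -
      have "(\<Sum>i<n. cnj (u' l i) * x i) = (\<Sum>i<n. \<Sum>k\<in>N. cnj (u' l i) * u k i * c k)"
        by (simp add: x_def sum_distrib_left mult_ac)
      also have "\<dots> = (\<Sum>k\<in>N. (\<Sum>i<n. cnj (u' l i) * u k i) * c k)"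
        by (subst sum.swap) (simp add: sum_distrib_right)
      finally have "(\<Sum>i<Suc n. cnj (u' l i) * x i) =
          (\<Sum>k\<in>N. (\<Sum>i<n. cnj (u' l i) * u k i) * c k) + cnj (u' l n) * c n"
        by (simp add: x_def)
      also have "(\<Sum>k\<in>N. (\<Sum>i<n. cnj (u' l i) * u k i) * c k) =
          (\<Sum>k\<in>N. M l k * c k)"
        using nN by (intro sum.cong) (auto simp: M_def)
      finally show ?thesis using c[rule_format, OF that] nN N(1) by (simp add: add.commute M_def)
    qed
    have coord: "(\<Sum>i<n. cnj (u k i) * x i) = (if k \<in> N then c k else 0)" if "k < n" for k
    proof -
      have "(\<Sum>i<n. cnj (u k i) * x i) = (\<Sum>i<n. \<Sum>l\<in>N. c l * (cnj (u k i) * u l i))"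
        by (simp add: x_def sum_distrib_left mult_ac)
      also have "\<dots> = (\<Sum>l\<in>N. c l * (\<Sum>i<n. cnj (u k i) * u l i))"
        by (subst sum.swap) (simp add: sum_distrib_left)
      also have "\<dots> = (\<Sum>l\<in>N. if l = k then c l else 0)"
        using that N(2) by (intro sum.cong) (auto simp: on)
      finally show ?thesis using N(1) by simp
    qed
    have norm_x: "(\<Sum>i<n. (cmod (x i))\<^sup>2) = s"
    proof -
      have "complex_of_real (\<Sum>i<n. (cmod (x i))\<^sup>2) = (\<Sum>i<n. x i * cnj (x i))"
        by (simp only: of_real_sum complex_norm_square)
      also have "\<dots> = (\<Sum>i<n. \<Sum>k\<in>N. cnj (c k) * (cnj (u k i) * x i))"
        by (intro sum.cong) (auto simp: x_def sum_distrib_left mult_ac)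
      also have "\<dots> = (\<Sum>k\<in>N. cnj (c k) * (\<Sum>i<n. cnj (u k i) * x i))"
        by (subst sum.swap) (simp add: sum_distrib_left)
      also have "\<dots> = (\<Sum>k\<in>N. cnj (c k) * c k)"
        using N(2) by (intro sum.cong) (auto simp: coord)
      also have "\<dots> = complex_of_real s"
        by (simp only: s_def of_real_sum complex_norm_square mult.commute)
      finally show ?thesis by (simp only: of_real_eq_iff)
    qed
    define q where "q = (\<Sum>i<Suc n. \<Sum>j<Suc n. cnj (x i) * A $$ (i, j) * x j)"
    have "q = (\<Sum>i<Suc n. \<Sum>j<Suc n.
        cnj (x i) * (\<Sum>k<Suc n. of_real (d' k) * u' k i * cnj (u' k j)) * x j)"
      unfolding q_def by (intro sum.cong refl) (simp only: Ae lessThan_iff)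
    also have "\<dots> = of_real (\<Sum>k<Suc n. d' k * (cmod (\<Sum>i<Suc n. cnj (u' k i) * x i))\<^sup>2)"
      by (rule hermitian_form_eigenbasis)
    finally have "Re q = (\<Sum>k<Suc n. d' k * (cmod (\<Sum>i<Suc n. cnj (u' k i) * x i))\<^sup>2)"
      by (simp only: Re_complex_of_real)
    \<comment> \<open>Only nonnegative eigenvalues of \<open>A\<close> contribute, since
      \<open>x\<close> is orthogonal to the negative eigenvectors.\<close>
    also have "\<dots> \<ge> 0"
    proof (rule sum_nonneg)
      fix k assume k: "k \<in> {..<Suc n}"
      show "0 \<le> d' k * (cmod (\<Sum>i<Suc n. cnj (u' k i) * x i))\<^sup>2"
      proof (cases "k \<in> N'")
        case True
        then show ?thesis by (simp only: orth) simp
      next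
        case False
        then show ?thesis using k by (simp add: N'_def not_less)
      qed
    qed
    finally have q0: "Re q \<ge> 0" .
    have Ppart: "Re (\<Sum>i<n. \<Sum>j<n. cnj (x i) * A $$ (i, j) * x j) \<le> - \<delta> * s"
    proof -
      have "(\<Sum>i<n. \<Sum>j<n. cnj (x i) * A $$ (i, j) * x j) =
          (\<Sum>i<n. \<Sum>j<n. cnj (x i) * (\<Sum>k<n. of_real (d k) * u k i * cnj (u k j)) * x j)"
        by (intro sum.cong refl) (simp only: AP Pe lessThan_iff)
      also have "\<dots> = of_real (\<Sum>k<n. d k * (cmod (\<Sum>i<n. cnj (u k i) * x i))\<^sup>2)"
        by (rule hermitian_form_eigenbasis)
      finally have "Re (\<Sum>i<n. \<Sum>j<n. cnj (x i) * A $$ (i, j) * x j) =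
          (\<Sum>k<n. d k * (cmod (\<Sum>i<n. cnj (u k i) * x i))\<^sup>2)" by (simp only: Re_complex_of_real)
      also have "\<dots> = (\<Sum>k<n. if k \<in> N then d k * (cmod (c k))\<^sup>2 else 0)"
        by (intro sum.cong) (auto simp: coord)
      also have "\<dots> = (\<Sum>k\<in>{..<n} \<inter> N. d k * (cmod (c k))\<^sup>2)" by (simp add: sum.inter_restrict)
      also have "{..<n} \<inter> N = N" using N(2) by auto
      also have "(\<Sum>k\<in>N. d k * (cmod (c k))\<^sup>2) \<le> (\<Sum>k\<in>N. - \<delta> * (cmod (c k))\<^sup>2)"
        using d\<delta> by (intro sum_mono mult_right_mono) auto
      finally show ?thesis by (simp add: s_def sum_distrib_left)
    qed
    have hAn: "A $$ (n, j) = cnj (A $$ (j, n))" if "j < n" for j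
      by (rule hA[rule_format]) (use that in auto)
    define S where "S = (\<Sum>i<n. cnj (x i) * A $$ (i, n) * c n)"
    have "q = (\<Sum>i<n. \<Sum>j<n. cnj (x i) * A $$ (i, j) * x j) + S
        + (\<Sum>j<n. cnj (c n) * A $$ (n, j) * x j) + cnj (c n) * A $$ (n, n) * c n"
      by (simp add: q_def S_def sum.distrib x_def)
    also have "(\<Sum>j<n. cnj (c n) * A $$ (n, j) * x j) = cnj S"
      unfolding S_def using hAn by (simp add: mult_ac)
    finally have "Re q = Re (\<Sum>i<n. \<Sum>j<n. cnj (x i) * A $$ (i, j) * x j) + 2 * Re S
        + Re (cnj (c n) * A $$ (n, n) * c n)"
      by simp
    also have "2 * Re S = (\<Sum>i<n. 2 * Re (cnj (x i) * A $$ (i, n) * c n))"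
      by (simp only: S_def Re_sum sum_distrib_left)
    also have "Re (cnj (c n) * A $$ (n, n) * c n) = (cmod (c n))\<^sup>2 * Re (A $$ (n, n))"
      unfolding cmod_power2 by (simp add: power2_eq_square algebra_simps)
    finally have q_eq: "Re q = Re (\<Sum>i<n. \<Sum>j<n. cnj (x i) * A $$ (i, j) * x j) +
        (\<Sum>i<n. 2 * Re (cnj (x i) * A $$ (i, n) * c n)) + (cmod (c n))\<^sup>2 * Re (A $$ (n, n))" .
    \<comment> \<open>The weight \<open>\<delta>\<close> is chosen so that the cross terms cost
      exactly \<open>\<delta> * s\<close> in terms of \<open>x\<close>, which the bound
      \<open>- \<delta> * s\<close> on the form of \<open>P\<close> pays for. Only multiples of |c
      n|^2 remain.\<close>
    have "(\<Sum>i<n. 2 * Re (cnj (x i) * A $$ (i, n) * c n)) \<le>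
        (\<Sum>i<n. \<delta> * (cmod (x i))\<^sup>2 + (cmod (c n))\<^sup>2 * (cmod (A $$ (i, n)))\<^sup>2 / \<delta>)"
    proof (rule sum_mono)
      fix i
      define b where "b = cmod (c n) * cmod (A $$ (i, n))"
      have "cmod (cnj (x i) * A $$ (i, n) * c n) = cmod (x i) * b"
        by (simp add: b_def norm_mult mult_ac)
      then have "2 * Re (cnj (x i) * A $$ (i, n) * c n) \<le> 2 * (cmod (x i) * b)"
        using complex_Re_le_cmod[of "cnj (x i) * A $$ (i, n) * c n"] by linarith
      also have "\<dots> \<le> \<delta> * (cmod (x i))\<^sup>2 + b\<^sup>2 / \<delta>"
        using weighted_am_gm[OF \<delta>] .
      also have "b\<^sup>2 / \<delta> = (cmod (c n))\<^sup>2 * (cmod (A $$ (i, n)))\<^sup>2 / \<delta>"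
        by (simp add: b_def power_mult_distrib)
      finally show "2 * Re (cnj (x i) * A $$ (i, n) * c n) \<le>
          \<delta> * (cmod (x i))\<^sup>2 + (cmod (c n))\<^sup>2 * (cmod (A $$ (i, n)))\<^sup>2 / \<delta>" .
    qed
    also have "\<dots> = \<delta> * s + (cmod (c n))\<^sup>2 * (1 / \<delta> * (\<Sum>i<n. (cmod (A $$ (i, n)))\<^sup>2))"
      by (simp add: sum.distrib norm_x[symmetric] sum_distrib_left)
    finally have "(\<Sum>i<n. 2 * Re (cnj (x i) * A $$ (i, n) * c n)) \<le>
        \<delta> * s + (cmod (c n))\<^sup>2 * (1 / \<delta> * (\<Sum>i<n. (cmod (A $$ (i, n)))\<^sup>2))" .
    then have main: "Re q \<le> Re (\<Sum>i<n. \<Sum>j<n. cnj (x i) * A $$ (i, j) * x j) + \<delta> * s +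
        (cmod (c n))\<^sup>2 * (1 / \<delta> * (\<Sum>i<n. (cmod (A $$ (i, n)))\<^sup>2) + Re (A $$ (n, n)))"
      unfolding q_eq distrib_left by linarith
    show "- (1 / \<delta>) * (\<Sum>i<n. (cmod (A $$ (i, n)))\<^sup>2) \<le> Re (A $$ (n, n))"
    proof (cases "c n = 0")
      case False
      have "0 \<le> (cmod (c n))\<^sup>2 * (1 / \<delta> * (\<Sum>i<n. (cmod (A $$ (i, n)))\<^sup>2) + Re (A $$ (n, n)))"
        using main q0 Ppart by linarith
      then have "0 \<le> 1 / \<delta> * (\<Sum>i<n. (cmod (A $$ (i, n)))\<^sup>2) + Re (A $$ (n, n))"
        using False by (simp add: zero_le_mult_iff)
      then show ?thesis by simp
    next
      \<comment> \<open>This case is contradictory: \<open>x\<close> is then a nonzero combination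
        of negative eigenvectors of \<open>P\<close>, where the form is at most
        \<open>- \<delta> * s\<close> and hence negative, against \<open>q0\<close>.\<close>
      case True
      then obtain k where k: "k \<in> N" "c k \<noteq> 0" using c0 by auto
      have "x n = 0" using True by (simp add: x_def)
      then have "q = (\<Sum>i<n. \<Sum>j<n. cnj (x i) * A $$ (i, j) * x j)" by (simp add: q_def)
      then have "\<delta> * s \<le> 0" using q0 Ppart by simp
      then have "s \<le> 0" using \<delta> by (simp add: mult_le_0_iff)
      moreover have "s \<ge> (cmod (c k))\<^sup>2" unfolding s_def using k N(1) by (intro member_le_sum) auto
      moreover have "(cmod (c k))\<^sup>2 > 0" using k by simp
      ultimately show ?thesis by linarith
    qed
  qed
qed

section \<open>The lower bound for the kernel from a bordered Pick matrix\<close>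

lemma nevanlinna_kernel_diagonal:
  assumes "Im z \<noteq> 0"
  shows "nevanlinna_kernel w z z = of_real (Im (w z) / Im z)"
proof -
  have "w z - cnj (w z) = \<i> * of_real (2 * Im (w z))" "z - cnj z = \<i> * of_real (2 * Im z)"
    by (simp_all add: complex_eq_iff)
  then show ?thesis using assms by (simp add: nevanlinna_kernel_def)
qed

lemma nevanlinna_kernel_commute: "nevanlinna_kernel w \<zeta> z = cnj (nevanlinna_kernel w z \<zeta>)"
proof -
  have "cnj (nevanlinna_kernel w z \<zeta>) = (- (w \<zeta> - cnj (w z))) / (- (\<zeta> - cnj z))"
    by (simp add: nevanlinna_kernel_def)
  also have "\<dots> = nevanlinna_kernel w \<zeta> z"
    unfolding minus_divide_divide by (simp add: nevanlinna_kernel_def)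
  finally show ?thesis by simp
qed

text \<open>The border entries are kernel values between \<open>z\<close> and fixed points, with
  denominators of modulus at least \<open>Im (zs ! i)\<close>. Hence the sum of their squares is at
  most a constant times 1 + |w z|^2, uniformly up to the real axis.\<close>

lemma generalized_nevanlinna_kernel_lower_bound:
  assumes "w \<in> generalized_nevanlinna \<kappa>"
  obtains C where "C \<ge> 0"
    "\<And>z. z \<in> analyticity_domain w \<Longrightarrow> - C * Im z * (1 + (cmod (w z))\<^sup>2) \<le> Im (w z)"
proof -
  from assms have bd: "\<And>zs. set zs \<subseteq> analyticity_domain w \<Longrightarrow> num_neg_eigenvalues (pick_matrix w zs) \<le> \<kappa>"
    unfolding generalized_nevanlinna_def by auto
  from assms obtain zs where zs: "set zs \<subseteq> analyticity_domain w"
    and nk: "num_neg_eigenvalues (pick_matrix w zs) = \<kappa>"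
    unfolding generalized_nevanlinna_def by auto
  define n where "n = length zs"
  have carr: "pick_matrix w zs' \<in> carrier_mat (length zs') (length zs')" for zs'
    by (simp add: pick_matrix_def)
  have herm: "pick_matrix w zs' $$ (j, i) = cnj (pick_matrix w zs' $$ (i, j))"
    if "i < length zs'" "j < length zs'" for i j zs'
    using that by (simp add: pick_matrix_def nevanlinna_kernel_commute[symmetric])
  have herm_zs: "\<forall>i<n. \<forall>j<n. pick_matrix w zs $$ (j, i) = cnj (pick_matrix w zs $$ (i, j))"
    by (intro allI impI herm) (simp_all add: n_def)
  obtain C where C0: "C \<ge> 0" and C: "\<forall>A. A \<in> carrier_mat (Suc n) (Suc n) \<and>
      (\<forall>i<Suc n. \<forall>j<Suc n. A $$ (j, i) = cnj (A $$ (i, j))) \<and>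
      (\<forall>i<n. \<forall>j<n. A $$ (i, j) = pick_matrix w zs $$ (i, j)) \<and>
      num_neg_eigenvalues A \<le> num_neg_eigenvalues (pick_matrix w zs) \<longrightarrow>
      - C * (\<Sum>i<n. (cmod (A $$ (i, n)))\<^sup>2) \<le> Re (A $$ (n, n))"
    using bordered_corner_lower_bound[OF carr[of zs, folded n_def] herm_zs]
    by (elim exE conjE) (rule that)
  \<comment> \<open>Each summand bounds one border entry: (a + b)^2 <= 2 (1 + b^2) (1 + a^2) serves
    for the numerator, the lower bound \<open>Im (zs ! i)\<close> for the denominator.\<close>
  define D where "D = (\<Sum>i<n. 2 * (1 + (cmod (w (zs ! i)))\<^sup>2) / (Im (zs ! i))\<^sup>2)"
  have D: "D \<ge> 0" by (auto simp: D_def intro!: sum_nonneg)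
  show ?thesis
  proof (rule that[of "C * D"])
    show "C * D \<ge> 0" using C0 D by simp
    fix z assume z: "z \<in> analyticity_domain w"
    then have imz: "Im z > 0" by (auto simp: analyticity_domain_def upper_half_plane_def)
    define A where "A = pick_matrix w (zs @ [z])"
    have A: "A \<in> carrier_mat (Suc n) (Suc n)" using carr[of "zs @ [z]"] by (simp add: A_def n_def)
    have b: "A $$ (i, n) = nevanlinna_kernel w z (zs ! i)" if "i < n" for i
      using that by (simp add: A_def pick_matrix_def n_def nth_append)
    have corner: "A $$ (n, n) = nevanlinna_kernel w z z"
      by (simp add: A_def pick_matrix_def n_def nth_append)
    have "- C * (\<Sum>i<n. (cmod (A $$ (i, n)))\<^sup>2) \<le> Re (A $$ (n, n))"
    proof (rule C[rule_format], intro conjI allI impI A)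
      show "A $$ (j, i) = cnj (A $$ (i, j))" if "i < Suc n" "j < Suc n" for i j
        unfolding A_def by (rule herm) (use that in \<open>simp_all add: n_def\<close>)
      show "A $$ (i, j) = pick_matrix w zs $$ (i, j)" if "i < n" "j < n" for i j
        using that by (simp add: A_def pick_matrix_def n_def nth_append)
      show "num_neg_eigenvalues A \<le> num_neg_eigenvalues (pick_matrix w zs)"
        using bd[of "zs @ [z]"] zs z by (simp add: A_def nk)
    qed
    moreover have "(\<Sum>i<n. (cmod (A $$ (i, n)))\<^sup>2) \<le> D * (1 + (cmod (w z))\<^sup>2)"
      unfolding D_def sum_distrib_right
    proof (rule sum_mono)
      fix i assume i: "i \<in> {..<n}"
      then have "zs ! i \<in> analyticity_domain w" using zs by (auto simp: n_def)
      then have imi: "Im (zs ! i) > 0" by (auto simp: analyticity_domain_def upper_half_plane_def)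
      have "Im (zs ! i) \<le> Im (z - cnj (zs ! i))" using imz by simp
      also have "\<dots> \<le> cmod (z - cnj (zs ! i))" using abs_Im_le_cmod[of "z - cnj (zs ! i)"] by linarith
      finally have den: "(Im (zs ! i))\<^sup>2 \<le> (cmod (z - cnj (zs ! i)))\<^sup>2" using imi by (intro power_mono) auto
      have "(cmod (w z - cnj (w (zs ! i))))\<^sup>2 \<le> (cmod (w z) + cmod (w (zs ! i)))\<^sup>2"
        using norm_triangle_ineq4[of "w z" "cnj (w (zs ! i))"] by (intro power_mono) auto
      also have "\<dots> \<le> 2 * (1 + (cmod (w (zs ! i)))\<^sup>2) * (1 + (cmod (w z))\<^sup>2)"
      proof -
        have "2 * (1 + b\<^sup>2) * (1 + a\<^sup>2) - (a + b)\<^sup>2 = 2 + (a - b)\<^sup>2 + 2 * (a * b)\<^sup>2" for a b :: real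
          by (simp add: power2_eq_square algebra_simps)
        moreover have "2 + (a - b)\<^sup>2 + 2 * (a * b)\<^sup>2 \<ge> 0" for a b :: real by simp
        ultimately show ?thesis by (metis diff_ge_0_iff_ge)
      qed
      finally have num: "(cmod (w z - cnj (w (zs ! i))))\<^sup>2 \<le>
          2 * (1 + (cmod (w (zs ! i)))\<^sup>2) * (1 + (cmod (w z))\<^sup>2)" .
      have "(cmod (A $$ (i, n)))\<^sup>2 = (cmod (w z - cnj (w (zs ! i))))\<^sup>2 / (cmod (z - cnj (zs ! i)))\<^sup>2"
        using i by (simp add: b nevanlinna_kernel_def norm_divide power_divide)
      also have "\<dots> \<le> 2 * (1 + (cmod (w (zs ! i)))\<^sup>2) * (1 + (cmod (w z))\<^sup>2) / (Im (zs ! i))\<^sup>2"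
        using num den imi by (intro frac_le) auto
      finally show "(cmod (A $$ (i, n)))\<^sup>2 \<le>
          2 * (1 + (cmod (w (zs ! i)))\<^sup>2) / (Im (zs ! i))\<^sup>2 * (1 + (cmod (w z))\<^sup>2)" by simp
    qed
    then have "C * (\<Sum>i<n. (cmod (A $$ (i, n)))\<^sup>2) \<le> C * (D * (1 + (cmod (w z))\<^sup>2))"
      using C0 by (rule mult_left_mono)
    ultimately have "- (C * D * (1 + (cmod (w z))\<^sup>2)) \<le> Im (w z) / Im z"
      using imz by (simp add: corner nevanlinna_kernel_diagonal)
    then show "- (C * D) * Im z * (1 + (cmod (w z))\<^sup>2) \<le> Im (w z)"
      using imz by (simp add: field_simps)
  qed
qed

section \<open>The Schwarz-Pick inequality in half discs\<close>

definition half_disc :: "real \<Rightarrow> real \<Rightarrow> complex set" where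
  "half_disc x0 r = {z. cmod (z - of_real x0) < r \<and> Im z > 0}"

lemma open_half_disc: "open (half_disc x0 r)"
proof -
  have "half_disc x0 r = ball (of_real x0) r \<inter> {z. Im z > 0}"
    by (auto simp: half_disc_def dist_norm norm_minus_commute)
  then show ?thesis by (simp add: open_Int open_halfspace_Im_gt)
qed

text \<open>The quotient of \<open>g\<close> by the Blaschke-type factor (z - s) b(z) is
  holomorphic, because the zeros at \<open>s\<close> cancel. As \<open>g\<close> has no boundary
  values, the maximum principle is applied on a level set of the factor at height c < 1. The closure
  of this set stays inside \<open>U\<close>, and on its frontier the quotient is at most 1 /
  c.\<close>

lemma holomorphic_le_comparison:
  fixes U :: "complex set"
  assumes U: "open U" "bounded U" and s: "s \<in> U"
    and b: "continuous_on (closure U) b" "b holomorphic_on U" "\<And>z. z \<in> U \<Longrightarrow> b z \<noteq> 0"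
    and fr: "\<And>z. z \<in> frontier U \<Longrightarrow> cmod ((z - s) * b z) \<ge> 1"
    and g: "g holomorphic_on U" "g s = 0" "\<And>z. z \<in> U \<Longrightarrow> cmod (g z) \<le> 1"
    and z: "z \<in> U"
  shows "cmod (g z) \<le> cmod ((z - s) * b z)"
proof (rule ccontr)
  define B where "B z = (z - s) * b z" for z
  assume "\<not> cmod (g z) \<le> cmod ((z - s) * b z)"
  then have less: "cmod (B z) < cmod (g z)" by (simp add: B_def)
  then have gz: "cmod (g z) > 0" using norm_ge_zero[of "B z"] by linarith
  have zs: "z \<noteq> s" using less g(2) by (auto simp: B_def)
  have "cmod (B z) / cmod (g z) < 1" using less gz by simp
  \<comment> \<open>\<open>c\<close> lies between the supposed ratio and 1: then \<open>z\<close>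
    belongs to the level set, and the bound 1 / c contradicts the left inequality.\<close>
  then obtain c where c: "cmod (B z) / cmod (g z) < c" "c < 1" using dense by blast
  have "cmod (B z) \<le> cmod (B z) / cmod (g z)"
    using g(3)[OF z] gz by (simp add: field_simps mult_left_le)
  then have Bc: "cmod (B z) < c" using c by linarith
  have c0: "c > 0" using Bc norm_ge_zero[of "B z"] by linarith
  have contB: "continuous_on (closure U) (\<lambda>z. cmod (B z))"
    unfolding B_def by (intro continuous_intros b)
  define S where "S = {z \<in> U. cmod (B z) < c}"
  have S_eq: "S = U \<inter> (\<lambda>z. cmod (B z)) -` {..<c}" by (auto simp: S_def)
  have openS: "open S"
    unfolding S_eq
    by (rule continuous_open_preimage[OF continuous_on_subset[OF contB closure_subset] U(1) open_lessThan])
  have clB: "cmod (B x) \<le> c" if "x \<in> closure S" for x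
  proof -
    have "closed {x \<in> closure U. cmod (B x) \<le> c}"
      using continuous_closed_preimage[OF contB closed_closure, of "{..c}"]
      by (auto simp: vimage_def Int_def conj_commute)
    moreover have "S \<subseteq> {x \<in> closure U. cmod (B x) \<le> c}"
      using closure_subset by (auto simp: S_def)
    ultimately have "closure S \<subseteq> {x \<in> closure U. cmod (B x) \<le> c}" by (rule closure_minimal[rotated])
    then show ?thesis using that by auto
  qed
  have clU: "closure S \<subseteq> U"
  proof
    fix x assume x: "x \<in> closure S"
    then have "x \<in> closure U" using closure_mono[of S U] by (auto simp: S_def)
    moreover have "x \<notin> frontier U" using clB[OF x] fr[of x] c(2) by (fastforce simp: B_def)
    ultimately show "x \<in> U" using U(1) by (simp add: frontier_def interior_open)
  qed
  \<comment> \<open>With the zero of \<open>g\<close> at \<open>s\<close> divided out,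
    \<open>G x / b x\<close> extends \<open>g x / B x\<close> holomorphically across
    \<open>s\<close>.\<close>
  define G where "G x = (if x = s then deriv g s else g x / (x - s))" for x
  have "G holomorphic_on U"
    by (rule pole_theorem_open_0[OF g(1) U(1), of s]) (auto simp: G_def g(2))
  then have u: "(\<lambda>x. G x / b x) holomorphic_on U" using b by (intro holomorphic_intros) auto
  have "cmod ((\<lambda>x. G x / b x) z) \<le> 1 / c"
  proof (rule maximum_modulus_frontier[of "\<lambda>x. G x / b x" S "1 / c" z])
    show "(\<lambda>x. G x / b x) holomorphic_on interior S"
      by (rule holomorphic_on_subset[OF u]) (use interior_subset in \<open>auto simp: S_def\<close>)
    show "continuous_on (closure S) (\<lambda>x. G x / b x)"
      by (rule continuous_on_subset[OF holomorphic_on_imp_continuous_on[OF u] clU])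
    show "bounded S" by (rule bounded_subset[OF U(2)]) (auto simp: S_def)
    show "z \<in> S" using z Bc by (simp add: S_def)
    fix x assume x: "x \<in> frontier S"
    then have xU: "x \<in> U" using clU by (auto simp: frontier_def)
    have "x \<notin> S" using x openS by (simp add: frontier_def interior_open)
    then have Bx: "cmod (B x) \<ge> c" using xU by (simp add: S_def)
    then have "x \<noteq> s" using c0 by (auto simp: B_def)
    then have "cmod (G x / b x) = cmod (g x) / cmod (B x)"
      by (simp add: G_def B_def norm_mult norm_divide)
    also have "\<dots> \<le> 1 / c" using g(3)[OF xU] Bx c0 by (intro frac_le) auto
    finally show "cmod (G x / b x) \<le> 1 / c" .
  qed
  moreover have "cmod (G z / b z) = cmod (g z) / cmod (B z)"
    using zs by (simp add: G_def B_def norm_mult norm_divide)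
  moreover have "B z \<noteq> 0" using zs b(3)[OF z] by (simp add: B_def)
  ultimately have "c * cmod (g z) \<le> cmod (B z)" using c0 by (simp add: field_simps)
  then show False using c(1) gz by (simp add: field_simps)
qed

text \<open>Pulling the Blaschke factor of the half plane back by the conformal map -(z + 1/z) of
  the unit half disc gives a function with the modulus of (z - s)(1 - z s) / ((z - cnj s)(1 - z cnj
  s)). The right side vanishes on the diameter and on the arc, so the modulus is 1 there.\<close>

lemma half_disc_blaschke_identity:
  "(cmod (z - cnj s))\<^sup>2 * (cmod (1 - z * cnj s))\<^sup>2 - (cmod (z - s))\<^sup>2 * (cmod (1 - z * s))\<^sup>2 =
    4 * Im z * Im s * (1 - (cmod z)\<^sup>2) * (1 - (cmod s)\<^sup>2)"
  unfolding cmod_power2 by (simp add: power2_eq_square algebra_simps)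

lemma disc_pseudohyperbolic_identity:
  "(cmod (1 - a * cnj b))\<^sup>2 - (cmod (a - b))\<^sup>2 = (1 - (cmod a)\<^sup>2) * (1 - (cmod b)\<^sup>2)"
  unfolding cmod_power2 by (simp add: power2_eq_square algebra_simps)

lemma closure_frontier_half_disc:
  assumes "z \<in> closure (half_disc 0 1)"
  shows "cmod z \<le> 1" "Im z \<ge> 0" "z \<in> frontier (half_disc 0 1) \<Longrightarrow> cmod z = 1 \<or> Im z = 0"
proof -
  have "closed (cball (0::complex) 1 \<inter> {z. Im z \<ge> 0})"
    by (intro closed_Int closed_cball closed_halfspace_Im_ge)
  moreover have "half_disc 0 1 \<subseteq> cball 0 1 \<inter> {z. Im z \<ge> 0}" by (auto simp: half_disc_def)
  ultimately have "closure (half_disc 0 1) \<subseteq> cball 0 1 \<inter> {z. Im z \<ge> 0}" by (rule closure_minimal[rotated])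
  then show *: "cmod z \<le> 1" "Im z \<ge> 0" using assms by auto
  assume "z \<in> frontier (half_disc 0 1)"
  then have "z \<notin> half_disc 0 1" using open_half_disc by (simp add: frontier_def interior_open)
  then show "cmod z = 1 \<or> Im z = 0" using * by (auto simp: half_disc_def)
qed

text \<open>The pseudohyperbolic distance of \<open>T z\<close> and \<open>T s\<close> is compared
  with the Blaschke factor of the half disc. The two identities then turn this into an inequality
  without quotients, which survives limits in which |T| reaches 1. The strict bound keeps
  \<open>1 - T z * cnj (T s)\<close> different from 0.\<close>

lemma schwarz_pick_unit_half_disc_strict:
  assumes T: "T holomorphic_on half_disc 0 1" "\<And>z. z \<in> half_disc 0 1 \<Longrightarrow> cmod (T z) < 1"
    and z: "z \<in> half_disc 0 1" and s: "s \<in> half_disc 0 1"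
  shows "4 * Im z * Im s * (1 - (cmod z)\<^sup>2) * (1 - (cmod s)\<^sup>2) * (cmod (1 - T z * cnj (T s)))\<^sup>2
    \<le> (cmod (z - cnj s))\<^sup>2 * (cmod (1 - z * cnj s))\<^sup>2 * ((1 - (cmod (T z))\<^sup>2) * (1 - (cmod (T s))\<^sup>2))"
proof -
  define U where "U = half_disc 0 1"
  have sU: "cmod s < 1" "Im s > 0" using s by (auto simp: half_disc_def)
  have d1: "z - cnj s \<noteq> 0" if "Im z \<ge> 0" for z using that sU by (auto simp: complex_eq_iff)
  have d2: "1 - z * s \<noteq> 0" "1 - z * cnj s \<noteq> 0" if "cmod z \<le> 1" for z
  proof -
    have "cmod z * cmod s < 1"
      using that sU mult_left_le_one_le[of "cmod s" "cmod z"] by simp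
    then have "cmod (z * s) \<noteq> 1" "cmod (z * cnj s) \<noteq> 1" by (auto simp: norm_mult)
    then show "1 - z * s \<noteq> 0" "1 - z * cnj s \<noteq> 0" by auto
  qed
  have d3: "1 - T z * cnj (T s) \<noteq> 0" if "z \<in> U" for z
  proof -
    have "cmod (T z) * cmod (T s) < 1 * 1"
      using T(2)[of z] T(2)[OF s] that by (intro mult_strict_mono') (auto simp: U_def)
    then have "cmod (T z * cnj (T s)) \<noteq> 1" by (auto simp: norm_mult)
    then show ?thesis by auto
  qed
  \<comment> \<open>The Blaschke factor of the half disc without its zero
    \<open>z - s\<close>.\<close>
  define b where "b z = (1 - z * s) / ((z - cnj s) * (1 - z * cnj s))" for z
  define g where "g z = (T z - T s) / (1 - T z * cnj (T s))" for z
  have "cmod (g z) \<le> cmod ((z - s) * b z)"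
  proof (rule holomorphic_le_comparison[of U])
    show "open U" by (simp add: U_def open_half_disc)
    show "bounded U" by (rule bounded_subset[of "ball 0 1"]) (auto simp: U_def half_disc_def)
    show "s \<in> U" "z \<in> U" using s z by (auto simp: U_def)
    have cl: "cmod z \<le> 1" "Im z \<ge> 0" if "z \<in> closure U" for z
      using closure_frontier_half_disc(1,2)[of z] that by (auto simp: U_def)
    then show "continuous_on (closure U) b"
      unfolding b_def using d1 d2 by (intro continuous_intros) auto
    have UU: "cmod z \<le> 1" "Im z \<ge> 0" if "z \<in> U" for z using that by (auto simp: U_def half_disc_def)
    then show "b holomorphic_on U"
      unfolding b_def using d1 d2 by (intro holomorphic_intros) auto
    show "b z \<noteq> 0" if "z \<in> U" for z using UU[OF that] d1 d2 by (auto simp: b_def)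
    show "g holomorphic_on U"
      unfolding g_def using d3 T(1) by (intro holomorphic_intros) (auto simp: U_def)
    show "g s = 0" by (simp add: g_def)
    show "cmod (g z) \<le> 1" if "z \<in> U" for z
    proof -
      have "(cmod (T z))\<^sup>2 \<le> 1" "(cmod (T s))\<^sup>2 \<le> 1"
        using T(2)[of z] T(2)[OF s] that by (auto simp: U_def power_le_one)
      then have "(cmod (T z - T s))\<^sup>2 \<le> (cmod (1 - T z * cnj (T s)))\<^sup>2"
        using disc_pseudohyperbolic_identity[of "T z" "T s"]
          mult_nonneg_nonneg[of "1 - (cmod (T z))\<^sup>2" "1 - (cmod (T s))\<^sup>2"] by linarith
      then have "cmod (T z - T s) \<le> cmod (1 - T z * cnj (T s))" by (rule power2_le_imp_le) simp
      then show ?thesis using d3[OF that] by (simp add: g_def norm_divide divide_le_eq_1)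
    qed
    show "1 \<le> cmod ((z - s) * b z)" if fr: "z \<in> frontier U" for z
    proof -
      have zc: "z \<in> closure U" using fr by (simp add: frontier_def)
      have "4 * Im z * Im s * (1 - (cmod z)\<^sup>2) * (1 - (cmod s)\<^sup>2) = 0"
        using closure_frontier_half_disc(3)[of z] zc fr by (auto simp: U_def)
      then have "(cmod (z - cnj s) * cmod (1 - z * cnj s))\<^sup>2 = (cmod (z - s) * cmod (1 - z * s))\<^sup>2"
        using half_disc_blaschke_identity[of z s] unfolding power_mult_distrib by linarith
      then have "cmod (z - cnj s) * cmod (1 - z * cnj s) = cmod (z - s) * cmod (1 - z * s)"
        by (simp add: power2_eq_iff_nonneg)
      moreover have "cmod (z - cnj s) * cmod (1 - z * cnj s) \<noteq> 0"
        using d1[OF cl(2)[OF zc]] d2(2)[OF cl(1)[OF zc]] by simp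
      ultimately show ?thesis by (simp add: b_def norm_mult norm_divide)
    qed
  qed
  define P Q where "P = cmod (1 - T z * cnj (T s))" and "Q = cmod (z - cnj s) * cmod (1 - z * cnj s)"
  have P: "P > 0" using d3[of z] z by (simp add: P_def U_def)
  have Q: "Q > 0" using d1[of z] d2(2)[of z] z by (auto simp: Q_def half_disc_def)
  have "cmod (T z - T s) / P \<le> cmod (z - s) * cmod (1 - z * s) / Q"
    using \<open>cmod (g z) \<le> _\<close> by (simp add: g_def b_def P_def Q_def norm_mult norm_divide)
  then have "cmod (T z - T s) * Q \<le> cmod (z - s) * cmod (1 - z * s) * P"
    using P Q by (simp add: field_simps)
  then have "(cmod (T z - T s) * Q)\<^sup>2 \<le> (cmod (z - s) * cmod (1 - z * s) * P)\<^sup>2"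
    using Q by (intro power_mono) auto
  then have *: "(cmod (T z - T s))\<^sup>2 * Q\<^sup>2 \<le> (cmod (z - s))\<^sup>2 * (cmod (1 - z * s))\<^sup>2 * P\<^sup>2"
    by (simp add: power_mult_distrib)
  define K L where "K = (1 - (cmod (T z))\<^sup>2) * (1 - (cmod (T s))\<^sup>2)"
    and "L = 4 * Im z * Im s * (1 - (cmod z)\<^sup>2) * (1 - (cmod s)\<^sup>2)"
  have e1: "(cmod (T z - T s))\<^sup>2 = P\<^sup>2 - K"
    using disc_pseudohyperbolic_identity[of "T z" "T s"] by (simp add: P_def K_def)
  have e2: "(cmod (z - s))\<^sup>2 * (cmod (1 - z * s))\<^sup>2 = Q\<^sup>2 - L"
    using half_disc_blaschke_identity[of z s] by (simp add: Q_def L_def power_mult_distrib)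
  have "L * P\<^sup>2 \<le> Q\<^sup>2 * K"
    using * unfolding e1 e2 by (simp add: algebra_simps)
  then show ?thesis by (simp add: P_def Q_def K_def L_def power_mult_distrib)
qed

text \<open>After rescaling to the unit half disc, \<open>t * T\<close> with t < 1 satisfies the
  strict bound, and t tends to 1. Within half the radius the factors that stem from the arc are
  bounded by constants, which cancel because 4 (3/4)^2 = (3/2)^2. What remains is the inequality of
  the half plane with 1 in place of the sharp constant 4.\<close>

lemma schwarz_pick_half_disc:
  assumes r: "r > 0"
    and T: "T holomorphic_on half_disc x0 r" "\<And>z. z \<in> half_disc x0 r \<Longrightarrow> cmod (T z) \<le> 1"
    and z: "z \<in> half_disc x0 (r / 2)" and s: "s \<in> half_disc x0 (r / 2)"
  shows "Im z * Im s * (cmod (1 - T z * cnj (T s)))\<^sup>2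
    \<le> (cmod (z - cnj s))\<^sup>2 * ((1 - (cmod (T z))\<^sup>2) * (1 - (cmod (T s))\<^sup>2))"
proof -
  define \<phi> where "\<phi> u = of_real x0 + of_real r * u" for u :: complex
  have \<phi>_mem: "\<phi> u \<in> half_disc x0 r" if "u \<in> half_disc 0 1" for u
    using that r by (auto simp: \<phi>_def half_disc_def norm_mult)
  define z' s' where "z' = (z - of_real x0) / of_real r" and "s' = (s - of_real x0) / of_real r"
  have \<phi>z: "\<phi> z' = z" "\<phi> s' = s" using r by (simp_all add: \<phi>_def z'_def s'_def)
  have zn: "cmod z' \<le> 1 / 2" "cmod s' \<le> 1 / 2"
    using z s r by (auto simp: z'_def s'_def half_disc_def norm_divide field_simps)
  have Im': "Im z' = Im z / r" "Im s' = Im s / r" by (simp_all add: z'_def s'_def Im_divide_of_real)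
  have pos: "Im z' > 0" "Im s' > 0" using z s r by (auto simp: Im' half_disc_def)
  have mem: "z' \<in> half_disc 0 1" "s' \<in> half_disc 0 1" using zn pos by (auto simp: half_disc_def)
  define Y where "Y = 4 * Im z' * Im s' * (1 - (cmod z')\<^sup>2) * (1 - (cmod s')\<^sup>2)"
  define X where "X = (cmod (z' - cnj s'))\<^sup>2 * (cmod (1 - z' * cnj s'))\<^sup>2"
  have main: "Y * (cmod (1 - T z * cnj (T s)))\<^sup>2 \<le> X * ((1 - (cmod (T z))\<^sup>2) * (1 - (cmod (T s))\<^sup>2))"
  proof (rule tendsto_le[where F = "at_left (1::real)"])
    show "((\<lambda>t. X * ((1 - (cmod (of_real t * T z))\<^sup>2) * (1 - (cmod (of_real t * T s))\<^sup>2)))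
        \<longlongrightarrow> X * ((1 - (cmod (T z))\<^sup>2) * (1 - (cmod (T s))\<^sup>2))) (at_left 1)"
      by (rule tendsto_eq_intros refl | simp)+
    show "((\<lambda>t. Y * (cmod (1 - of_real t * T z * cnj (of_real t * T s)))\<^sup>2)
        \<longlongrightarrow> Y * (cmod (1 - T z * cnj (T s)))\<^sup>2) (at_left 1)"
      by (rule tendsto_eq_intros refl | simp)+
    have "eventually (\<lambda>t::real. t \<in> {0<..<1}) (at_left 1)"
      by (rule eventually_at_leftI[of 0]) auto
    then show "\<forall>\<^sub>F t in at_left 1. Y * (cmod (1 - of_real t * T z * cnj (of_real t * T s)))\<^sup>2
        \<le> X * ((1 - (cmod (of_real t * T z))\<^sup>2) * (1 - (cmod (of_real t * T s))\<^sup>2))"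
    proof eventually_elim
      case (elim t)
      have hol: "(\<lambda>u. of_real t * T (\<phi> u)) holomorphic_on half_disc 0 1"
      proof -
        have "\<phi> holomorphic_on half_disc 0 1" unfolding \<phi>_def by (intro holomorphic_intros)
        then have "T \<circ> \<phi> holomorphic_on half_disc 0 1"
          by (rule holomorphic_on_compose_gen[OF _ T(1)]) (use \<phi>_mem in auto)
        then show ?thesis by (intro holomorphic_intros) (simp add: comp_def)
      qed
      have lt: "cmod (of_real t * T (\<phi> u)) < 1" if "u \<in> half_disc 0 1" for u
      proof -
        have "t * cmod (T (\<phi> u)) \<le> t" using T(2)[OF \<phi>_mem[OF that]] elim by (intro mult_left_le) auto
        moreover have "cmod (of_real t * T (\<phi> u)) = t * cmod (T (\<phi> u))" using elim by (simp add: norm_mult)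
        ultimately show ?thesis using elim unfolding greaterThanLessThan_iff by linarith
      qed
      show ?case
        using schwarz_pick_unit_half_disc_strict[OF hol lt mem] unfolding \<phi>z Y_def X_def .
    qed
  qed simp
  have nn: "(1 - (cmod (T z))\<^sup>2) * (1 - (cmod (T s))\<^sup>2) \<ge> 0"
    using T(2)[of z] T(2)[of s] z s r
    by (intro mult_nonneg_nonneg) (auto simp: half_disc_def abs_square_le_1)
  have q: "1 - (cmod z')\<^sup>2 \<ge> 3 / 4" "1 - (cmod s')\<^sup>2 \<ge> 3 / 4"
    using power_mono[OF zn(1), of 2] power_mono[OF zn(2), of 2] by (simp_all add: power2_eq_square)
  have "Im z' * Im s' * (9 / 4) \<le> Y"
  proof -
    have "(3 / 4) * (3 / 4) \<le> (1 - (cmod z')\<^sup>2) * (1 - (cmod s')\<^sup>2)" using q by (intro mult_mono) auto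
    then have "4 * (Im z' * Im s') * ((3 / 4) * (3 / 4)) \<le>
        4 * (Im z' * Im s') * ((1 - (cmod z')\<^sup>2) * (1 - (cmod s')\<^sup>2))"
      using pos by (intro mult_left_mono) auto
    then show ?thesis by (simp add: Y_def mult_ac)
  qed
  then have "Im z' * Im s' * (9 / 4) * (cmod (1 - T z * cnj (T s)))\<^sup>2 \<le> Y * (cmod (1 - T z * cnj (T s)))\<^sup>2"
    by (intro mult_right_mono) auto
  also note main
  also have "X * ((1 - (cmod (T z))\<^sup>2) * (1 - (cmod (T s))\<^sup>2)) \<le>
      (cmod (z' - cnj s'))\<^sup>2 * (9 / 4) * ((1 - (cmod (T z))\<^sup>2) * (1 - (cmod (T s))\<^sup>2))"
  proof -
    have "cmod (z' * cnj s') \<le> (1 / 2) * (1 / 2)"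
      unfolding norm_mult using zn by (intro mult_mono) auto
    then have "cmod (1 - z' * cnj s') \<le> 3 / 2"
      using norm_triangle_ineq4[of 1 "z' * cnj s'"] by simp
    then have "(cmod (1 - z' * cnj s'))\<^sup>2 \<le> (3 / 2)\<^sup>2" by (intro power_mono) auto
    then show ?thesis
      unfolding X_def using nn by (intro mult_right_mono mult_left_mono) (auto simp: power2_eq_square)
  qed
  finally have fin: "Im z' * Im s' * (cmod (1 - T z * cnj (T s)))\<^sup>2 \<le>
      (cmod (z' - cnj s'))\<^sup>2 * ((1 - (cmod (T z))\<^sup>2) * (1 - (cmod (T s))\<^sup>2))" by (simp add: mult_ac)
  have "z' - cnj s' = (z - cnj s) / of_real r" by (simp add: z'_def s'_def diff_divide_distrib)
  then have "(cmod (z' - cnj s'))\<^sup>2 = (cmod (z - cnj s))\<^sup>2 / r\<^sup>2"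
    using r by (simp add: norm_divide power_divide)
  with fin have "Im z * Im s * (cmod (1 - T z * cnj (T s)))\<^sup>2 / r\<^sup>2 \<le>
      (cmod (z - cnj s))\<^sup>2 * ((1 - (cmod (T z))\<^sup>2) * (1 - (cmod (T s))\<^sup>2)) / r\<^sup>2"
    by (simp add: Im' power2_eq_square)
  then show ?thesis using r by (simp add: divide_le_cancel)
qed

section \<open>Cayley transforms and poles\<close>

lemma cayley_tendsto_1:
  assumes "filterlim F at_infinity G"
  shows "((\<lambda>z. (F z - \<i>) / (F z + \<i>)) \<longlongrightarrow> 1) G"
proof -
  have lim: "filterlim (\<lambda>z. \<i> + F z) at_infinity G"
    using tendsto_add_filterlim_at_infinity[OF tendsto_const assms] .
  have "((\<lambda>z. 1 - 2 * \<i> * inverse (\<i> + F z)) \<longlongrightarrow> 1 - 2 * \<i> * 0) G"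
    by (intro tendsto_intros filterlim_compose[OF tendsto_inverse_0 lim])
  then have "((\<lambda>z. 1 - 2 * \<i> * inverse (\<i> + F z)) \<longlongrightarrow> 1) G" by simp
  moreover have "eventually (\<lambda>z. \<i> + F z \<noteq> 0) G"
    using filterlim_at_infinity_imp_eventually_ne[OF lim] .
  then have "eventually (\<lambda>z. 1 - 2 * \<i> * inverse (\<i> + F z) = (F z - \<i>) / (F z + \<i>)) G"
    by eventually_elim (simp add: field_simps)
  ultimately show ?thesis by (rule Lim_transform_eventually)
qed

text \<open>The transform equals 1 - 2 i / (F + i) and so tends to 1 at a pole of \<open>F\<close>,
  which makes the singularity removable with the value 1. At a point of analyticity the denominator
  is nonzero by \<open>ne\<close>.\<close>

lemma cayley_extension_holomorphic:
  assumes D: "open D" and F: "F meromorphic_on D" "\<And>z. z \<in> D \<Longrightarrow> F analytic_on {z} \<or> is_pole F z"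
    and ne: "\<And>z. z \<in> D \<Longrightarrow> F analytic_on {z} \<Longrightarrow> F z \<noteq> - \<i>"
  shows "(\<lambda>z. if F analytic_on {z} then (F z - \<i>) / (F z + \<i>) else 1) holomorphic_on D"
proof -
  define T where "T z = (if F analytic_on {z} then (F z - \<i>) / (F z + \<i>) else 1)" for z
  have "T analytic_on {p}" if p: "p \<in> D" for p
  proof -
    have "eventually (\<lambda>z. F analytic_on {z}) (at p)"
      using meromorphic_on_isolated_singularity[of F p] meromorphic_on_subset[OF F(1), of "{p}"] p
      by (simp add: isolated_singularity_at_altdef)
    moreover have "eventually (\<lambda>z. z \<in> D) (at p)" using D p by (simp add: eventually_at_in_open')
    ultimately have ev: "eventually (\<lambda>z. F analytic_on {z} \<and> z \<in> D) (at p)" by (rule eventually_conj)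
    then obtain e where e: "e > 0" "\<And>z. z \<in> ball p e - {p} \<Longrightarrow> F analytic_on {z} \<and> z \<in> D"
      unfolding eventually_at by (auto simp: dist_commute)
    have hol: "T holomorphic_on ball p e - {p}"
    proof -
      have "F analytic_on ball p e - {p}" using e(2) analytic_on_analytic_at by blast
      then have "F holomorphic_on ball p e - {p}" by (rule analytic_imp_holomorphic)
      then have "(\<lambda>z. (F z - \<i>) / (F z + \<i>)) holomorphic_on ball p e - {p}"
        using e(2) ne by (intro holomorphic_intros) (auto simp: add_eq_0_iff2)
      then show ?thesis by (rule holomorphic_transform) (use e(2) in \<open>auto simp: T_def\<close>)
    qed
    have "((\<lambda>z. (F z - \<i>) / (F z + \<i>)) \<longlongrightarrow> T p) (at p)"
    proof (cases "F analytic_on {p}")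
      case True
      then have "F \<midarrow>p\<rightarrow> F p" using analytic_at_imp_isCont[OF True] by (simp add: isCont_def)
      moreover have "F p + \<i> \<noteq> 0" using ne[OF p True] by (simp add: add_eq_0_iff2)
      ultimately have "((\<lambda>z. (F z - \<i>) / (F z + \<i>)) \<longlongrightarrow> (F p - \<i>) / (F p + \<i>)) (at p)"
        by (intro tendsto_intros)
      then show ?thesis using True by (simp add: T_def)
    next
      case False
      then have "is_pole F p" using F(2)[OF p] by simp
      then show ?thesis using cayley_tendsto_1[of F "at p"] False by (simp add: T_def is_pole_def)
    qed
    then have lim: "(T \<longlongrightarrow> T p) (at p)"
      by (rule Lim_transform_eventually) (use ev in \<open>eventually_elim, simp add: T_def\<close>)
    have "T holomorphic_on ball p e"
      by (rule no_isolated_singularity'[of "{p}"]) (auto intro: hol tendsto_within_subset[OF lim])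
    then show ?thesis using e(1) by (auto simp: analytic_at intro!: exI[of _ "ball p e"])
  qed
  then have "T analytic_on D" using analytic_on_analytic_at by blast
  then show ?thesis unfolding T_def by (rule analytic_imp_holomorphic)
qed

lemma cayley_norm:
  assumes "u \<noteq> - \<i>"
  shows "1 - (cmod ((u - \<i>) / (u + \<i>)))\<^sup>2 = 4 * Im u / (cmod (u + \<i>))\<^sup>2"
proof -
  have "cmod (u + \<i>) \<noteq> 0" using assms by (auto simp: add_eq_0_iff2)
  then have "1 - (cmod (u - \<i>))\<^sup>2 / (cmod (u + \<i>))\<^sup>2 =
      ((cmod (u + \<i>))\<^sup>2 - (cmod (u - \<i>))\<^sup>2) / (cmod (u + \<i>))\<^sup>2"
    by (simp add: diff_divide_distrib)
  also have "(cmod (u + \<i>))\<^sup>2 - (cmod (u - \<i>))\<^sup>2 = 4 * Im u"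
    unfolding cmod_power2 by (simp add: power2_eq_square algebra_simps)
  finally show ?thesis by (simp only: norm_divide power_divide)
qed

text \<open>For the Cayley transform \<open>T\<close> of \<open>F\<close>, 1 - T(z) cnj (T(s)) is a
  multiple of F(z) - cnj (F(s)) with denominator (F(z) + i)(cnj (F(s)) - i). The squared moduli of
  the same two factors divide the product of the defects 1 - |T(z)|^2 and 1 - |T(s)|^2, so they
  cancel.\<close>

lemma schwarz_pick_upper_half_plane:
  assumes r: "r > 0" and F: "F meromorphic_on half_disc x0 r"
      "\<And>z. z \<in> half_disc x0 r \<Longrightarrow> F analytic_on {z} \<or> is_pole F z"
    and Im: "\<And>z. z \<in> half_disc x0 r \<Longrightarrow> F analytic_on {z} \<Longrightarrow> Im (F z) \<ge> 0"
    and z: "z \<in> half_disc x0 (r / 2)" "F analytic_on {z}"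
    and s: "s \<in> half_disc x0 (r / 2)" "F analytic_on {s}"
  shows "Im z * Im s * (cmod (F z - cnj (F s)))\<^sup>2 \<le> 4 * (cmod (z - cnj s))\<^sup>2 * (Im (F z) * Im (F s))"
proof -
  define T where "T z = (if F analytic_on {z} then (F z - \<i>) / (F z + \<i>) else 1)" for z
  have ne: "F z \<noteq> - \<i>" if "z \<in> half_disc x0 r" "F analytic_on {z}" for z
    using Im[OF that] by auto
  have hol: "T holomorphic_on half_disc x0 r"
    unfolding T_def by (rule cayley_extension_holomorphic[OF open_half_disc F ne])
  have T1: "cmod (T u) \<le> 1" if "u \<in> half_disc x0 r" for u
  proof (cases "F analytic_on {u}")
    case True
    then have "1 - (cmod (T u))\<^sup>2 = 4 * Im (F u) / (cmod (F u + \<i>))\<^sup>2"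
      using cayley_norm[OF ne[OF that True]] by (simp add: T_def)
    also have "\<dots> \<ge> 0" using Im[OF that True] by simp
    finally show ?thesis by (simp add: abs_square_le_1)
  qed (simp add: T_def)
  have sub: "half_disc x0 (r / 2) \<subseteq> half_disc x0 r" using r by (auto simp: half_disc_def)
  define a b where "a = F z" and "b = F s"
  have ab: "a \<noteq> - \<i>" "b \<noteq> - \<i>" using ne[of z] ne[of s] z s sub by (auto simp: a_def b_def)
  then have nz: "a + \<i> \<noteq> 0" "b + \<i> \<noteq> 0" "cnj b - \<i> \<noteq> 0"
    by (auto simp: add_eq_0_iff2 complex_eq_iff)
  have Tz: "T z = (a - \<i>) / (a + \<i>)" "T s = (b - \<i>) / (b + \<i>)" using z s by (simp_all add: T_def a_def b_def)
  have 1: "1 - (cmod (T z))\<^sup>2 = 4 * Im a / (cmod (a + \<i>))\<^sup>2" "1 - (cmod (T s))\<^sup>2 = 4 * Im b / (cmod (b + \<i>))\<^sup>2"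
    unfolding Tz using cayley_norm[OF ab(1)] cayley_norm[OF ab(2)] .
  have "1 - T z * cnj (T s) = 1 - (a - \<i>) * (cnj b + \<i>) / ((a + \<i>) * (cnj b - \<i>))"
    by (simp add: Tz)
  also have "\<dots> = ((a + \<i>) * (cnj b - \<i>) - (a - \<i>) * (cnj b + \<i>)) / ((a + \<i>) * (cnj b - \<i>))"
    using nz by (simp add: diff_divide_distrib)
  also have "(a + \<i>) * (cnj b - \<i>) - (a - \<i>) * (cnj b + \<i>) = - 2 * \<i> * (a - cnj b)"
    by (simp add: algebra_simps)
  finally have "1 - T z * cnj (T s) = - 2 * \<i> * (a - cnj b) / ((a + \<i>) * (cnj b - \<i>))" .
  then have "cmod (1 - T z * cnj (T s)) = 2 * cmod (a - cnj b) / (cmod (a + \<i>) * cmod (cnj b - \<i>))"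
    by (simp add: norm_mult norm_divide)
  also have "cmod (cnj b - \<i>) = cmod (b + \<i>)"
    using complex_mod_cnj[of "b + \<i>"] by simp
  finally have 2: "(cmod (1 - T z * cnj (T s)))\<^sup>2 =
      4 * (cmod (a - cnj b))\<^sup>2 / ((cmod (a + \<i>))\<^sup>2 * (cmod (b + \<i>))\<^sup>2)"
    by (simp add: power_divide power_mult_distrib)
  define N where "N = (cmod (a + \<i>))\<^sup>2 * (cmod (b + \<i>))\<^sup>2"
  have N: "N > 0" using nz by (simp add: N_def)
  have "Im z * Im s * (4 * (cmod (a - cnj b))\<^sup>2 / N) \<le>
      (cmod (z - cnj s))\<^sup>2 * (16 * (Im a * Im b) / N)"
    using schwarz_pick_half_disc[OF r hol T1 z(1) s(1)]
    unfolding 1 2 N_def by (simp add: mult_ac)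
  then have "(Im z * Im s * (4 * (cmod (a - cnj b))\<^sup>2)) / N \<le> ((cmod (z - cnj s))\<^sup>2 * (16 * (Im a * Im b))) / N"
    by simp
  then have "Im z * Im s * (4 * (cmod (a - cnj b))\<^sup>2) \<le> (cmod (z - cnj s))\<^sup>2 * (16 * (Im a * Im b))"
    using N by (simp add: divide_le_cancel)
  then show ?thesis by (simp add: a_def b_def mult_ac)
qed

section \<open>Nontangential limits\<close>

lemma nontangential_sectorD:
  assumes "z \<in> nontangential_sector x0 a"
  shows "Im z > 0" "\<bar>Re z - x0\<bar> < a * Im z" "cmod (z - of_real x0) \<le> (a + 1) * Im z"
proof -
  show *: "Im z > 0" "\<bar>Re z - x0\<bar> < a * Im z"
    using assms by (auto simp: nontangential_sector_def upper_half_plane_def)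
  show "cmod (z - of_real x0) \<le> (a + 1) * Im z"
    using cmod_le[of "z - of_real x0"] * by (simp add: distrib_right)
qed

lemma open_upper_half_plane: "open upper_half_plane"
  by (simp add: upper_half_plane_def open_halfspace_Im_gt)

lemma open_nontangential_sector: "open (nontangential_sector x0 a)"
proof -
  have "open {z. \<bar>Re z - x0\<bar> < a * Im z}"
    by (intro open_Collect_less continuous_intros)
  moreover have "nontangential_sector x0 a = upper_half_plane \<inter> {z. \<bar>Re z - x0\<bar> < a * Im z}"
    by (auto simp: nontangential_sector_def)
  ultimately show ?thesis by (simp add: open_Int open_upper_half_plane)
qed

lemma convex_nontangential_sector: "convex (nontangential_sector x0 a)"
proof (rule convexI)
  fix p q and u v :: real
  assume p: "p \<in> nontangential_sector x0 a" and q: "q \<in> nontangential_sector x0 a"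
    and uv: "0 \<le> u" "0 \<le> v" "u + v = 1"
  note P = nontangential_sectorD[OF p] and Q = nontangential_sectorD[OF q]
  have "u * Im p + v * Im q > 0"
    using P(1) Q(1) uv by (metis add_0 add_nonneg_pos add_pos_nonneg less_eq_real_def mult_nonneg_nonneg
        mult_pos_pos zero_neq_one)
  moreover have "\<bar>u * Re p + v * Re q - x0\<bar> < a * (u * Im p + v * Im q)"
  proof -
    have "u * Re p + v * Re q - x0 = u * (Re p - x0) + v * (Re q - x0)"
      using uv(3) by (simp add: algebra_simps) (metis distrib_right mult_1)
    then have "\<bar>u * Re p + v * Re q - x0\<bar> \<le> u * \<bar>Re p - x0\<bar> + v * \<bar>Re q - x0\<bar>"
      using uv abs_triangle_ineq[of "u * (Re p - x0)" "v * (Re q - x0)"] by (simp add: abs_mult)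
    also have "\<dots> < u * (a * Im p) + v * (a * Im q)"
    proof (cases "u = 0")
      case True
      then show ?thesis using uv Q by simp
    next
      case False
      then have "u * \<bar>Re p - x0\<bar> < u * (a * Im p)" using uv P by simp
      moreover have "v * \<bar>Re q - x0\<bar> \<le> v * (a * Im q)" using uv Q by (intro mult_left_mono) auto
      ultimately show ?thesis by linarith
    qed
    finally show ?thesis by (simp add: algebra_simps)
  qed
  ultimately show "u *\<^sub>R p + v *\<^sub>R q \<in> nontangential_sector x0 a"
    by (simp add: nontangential_sector_def upper_half_plane_def)
qed

lemma nt_limit_iff:
  "nt_limit w x0 f L \<longleftrightarrow> (\<forall>a>0. \<forall>e>0. \<exists>\<delta>>0. \<forall>z\<in>analyticity_domain w \<inter> nontangential_sector x0 a.
      cmod (z - of_real x0) < \<delta> \<longrightarrow> cmod (f z - of_real L) < e)"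
proof -
  have "z \<noteq> of_real x0" if "z \<in> nontangential_sector x0 a" for z a
    using nontangential_sectorD(1)[OF that] by auto
  then show ?thesis
    unfolding nt_limit_def tendsto_iff eventually_at dist_norm by (meson IntD2)
qed

lemma nt_limit_value_of_quotient:
  assumes q: "nt_limit w x0 (\<lambda>z. (w z - of_real w0) / (z - of_real x0)) d"
  shows "nt_limit w x0 w w0"
  unfolding nt_limit_def
proof (intro allI impI)
  fix a :: real assume a: "a > 0"
  let ?G = "at (complex_of_real x0) within (analyticity_domain w \<inter> nontangential_sector x0 a)"
  have "((\<lambda>z. of_real w0 + (w z - of_real w0) / (z - of_real x0) * (z - of_real x0)) \<longlongrightarrow>
      of_real w0 + of_real d * (of_real x0 - of_real x0)) ?G"
    using q a unfolding nt_limit_def by (intro tendsto_intros) auto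
  moreover have "eventually (\<lambda>z. of_real w0 + (w z - of_real w0) / (z - of_real x0) * (z - of_real x0) = w z) ?G"
    unfolding eventually_at_filter by (rule always_eventually) auto
  ultimately show "(w \<longlongrightarrow> of_real w0) ?G" by (simp add: Lim_transform_eventually)
qed

text \<open>Since \<open>w0\<close>, \<open>d\<close> and \<open>x0\<close> are real, the imaginary
  part of w(z) = w0 + (d + h(z)) (z - x0) shows that Im w - d Im z is at most |h| |z - x0|. In a
  sector this is at most (a + 1) |h| Im z.\<close>

lemma nt_kernel_limit_of_quotient:
  assumes q: "nt_limit w x0 (\<lambda>z. (w z - of_real w0) / (z - of_real x0)) d"
  shows "nt_limit w x0 (\<lambda>z. nevanlinna_kernel w z z) d"
  unfolding nt_limit_iff
proof (intro allI impI)
  fix a e :: real assume a: "a > 0" and e: "e > 0"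
  then obtain \<delta> where \<delta>: "\<delta> > 0" "\<And>z. z \<in> analyticity_domain w \<inter> nontangential_sector x0 a \<Longrightarrow>
      cmod (z - of_real x0) < \<delta> \<Longrightarrow> cmod ((w z - of_real w0) / (z - of_real x0) - of_real d) < e / (a + 1)"
    using q[unfolded nt_limit_iff, rule_format, OF a, of "e / (a + 1)"] by auto
  have "cmod (nevanlinna_kernel w z z - of_real d) < e"
    if z: "z \<in> analyticity_domain w \<inter> nontangential_sector x0 a" and zd: "cmod (z - of_real x0) < \<delta>" for z
  proof -
    note S = nontangential_sectorD[of z x0 a]
    have y: "Im z > 0" using S z by blast
    then have zx: "z \<noteq> of_real x0" by auto
    define h where "h = (w z - of_real w0) / (z - of_real x0) - of_real d"
    have "(w z - of_real w0) / (z - of_real x0) * (z - of_real x0) = w z - of_real w0" using zx by simp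
    then have "h * (z - of_real x0) = w z - of_real w0 - of_real d * (z - of_real x0)"
      unfolding h_def by (subst left_diff_distrib) simp
    then have "Im (h * (z - of_real x0)) = Im (w z) - d * Im z" by simp
    then have "\<bar>Im (w z) - d * Im z\<bar> \<le> cmod h * cmod (z - of_real x0)"
      using abs_Im_le_cmod[of "h * (z - of_real x0)"] by (simp only: norm_mult)
    also have "\<dots> \<le> cmod h * ((a + 1) * Im z)" using S z by (intro mult_left_mono) auto
    also have "\<dots> < e / (a + 1) * ((a + 1) * Im z)"
      using \<delta>(2)[OF z zd] a y by (intro mult_strict_right_mono) (auto simp: h_def)
    also have "\<dots> = e * Im z" using a by simp
    finally have *: "\<bar>Im (w z) - d * Im z\<bar> < e * Im z" .
    have "nevanlinna_kernel w z z - of_real d = of_real ((Im (w z) - d * Im z) / Im z)"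
      using y by (simp add: nevanlinna_kernel_diagonal diff_divide_distrib)
    then have "cmod (nevanlinna_kernel w z z - of_real d) = \<bar>Im (w z) - d * Im z\<bar> / Im z"
      using y by (simp only: norm_of_real) (simp add: abs_divide)
    then show ?thesis using * y by (simp add: divide_less_eq)
  qed
  then show "\<exists>\<delta>>0. \<forall>z\<in>analyticity_domain w \<inter> nontangential_sector x0 a.
      cmod (z - of_real x0) < \<delta> \<longrightarrow> cmod (nevanlinna_kernel w z z - of_real d) < e" using \<delta>(1) by blast
qed

section \<open>Absence of poles in sectors; derivative and difference quotient\<close>

context
  fixes w :: "complex \<Rightarrow> complex" and x0 :: real
  assumes w: "w nicely_meromorphic_on upper_half_plane"
begin

lemma analytic_or_pole: "z \<in> upper_half_plane \<Longrightarrow> w analytic_on {z} \<or> is_pole w z"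
  using nicely_meromorphic_on_imp_analytic_at[OF w] by blast

lemma eventually_analyticity_domain:
  assumes "p \<in> upper_half_plane"
  shows "eventually (\<lambda>z. z \<in> analyticity_domain w) (at p)"
proof -
  have "w meromorphic_on {p}"
    using w assms meromorphic_on_subset[of w upper_half_plane "{p}"] by (simp add: nicely_meromorphic_on_def)
  then have "eventually (\<lambda>z. w analytic_on {z}) (at p)"
    using meromorphic_on_isolated_singularity by (simp add: isolated_singularity_at_altdef)
  moreover have "eventually (\<lambda>z. z \<in> upper_half_plane) (at p)"
    using assms open_upper_half_plane by (simp add: eventually_at_in_open')
  ultimately show ?thesis by eventually_elim (simp add: analyticity_domain_def)
qed

text \<open>A point on the vertical line above \<open>x0\<close> may be a pole, but poles are
  isolated, so there are points of analyticity next to it in the open sector.\<close>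

lemma nt_filter_nontrivial:
  assumes "a > 0"
  shows "at (complex_of_real x0) within (analyticity_domain w \<inter> nontangential_sector x0 a) \<noteq> bot"
proof -
  have "of_real x0 islimpt (analyticity_domain w \<inter> nontangential_sector x0 a)"
    unfolding islimpt_approachable
  proof (intro allI impI)
    fix e :: real assume e: "e > 0"
    define p where "p = Complex x0 (e / 2)"
    have p: "p \<in> nontangential_sector x0 a"
      using e assms by (simp add: p_def nontangential_sector_def upper_half_plane_def)
    have "p - of_real x0 = \<i> * of_real (e / 2)" by (simp add: p_def complex_eq_iff)
    then have "dist p (of_real x0) = e / 2" using e by (simp only: dist_norm norm_mult norm_ii norm_of_real)
    then have "dist p (of_real x0) < e" using e by simp
    then have "eventually (\<lambda>z. z \<in> nontangential_sector x0 a \<inter> ball (of_real x0) e) (at p)"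
      using p by (intro eventually_at_in_open') (auto simp: open_Int open_nontangential_sector dist_commute)
    moreover have "eventually (\<lambda>z. z \<in> analyticity_domain w) (at p)"
      using p by (intro eventually_analyticity_domain) (simp add: nontangential_sector_def)
    ultimately have "eventually (\<lambda>z. z \<in> analyticity_domain w \<inter> nontangential_sector x0 a \<inter>
        ball (of_real x0) e) (at p)" by eventually_elim auto
    then obtain z where z: "z \<in> analyticity_domain w \<inter> nontangential_sector x0 a \<inter> ball (of_real x0) e"
      using eventually_happens[of _ "at p"] by auto
    moreover have "z \<noteq> of_real x0" using z nontangential_sectorD(1)[of z x0 a] by auto
    ultimately show "\<exists>z\<in>analyticity_domain w \<inter> nontangential_sector x0 a.
        z \<noteq> of_real x0 \<and> dist z (of_real x0) < e" by (auto simp: dist_commute)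
  qed
  then show ?thesis by (simp add: trivial_limit_within)
qed

lemma nt_limit_unique:
  assumes "nt_limit w x0 f L" "nt_limit w x0 f M"
  shows "L = M"
proof -
  have "complex_of_real L = complex_of_real M"
    using tendsto_unique[OF nt_filter_nontrivial[of 1], of f "of_real L" "of_real M"] assms
    unfolding nt_limit_def by simp
  then show ?thesis by simp
qed

text \<open>\<open>nt_limit\<close> sees only points of analyticity, so poles have to be excluded
  before estimates on whole discs or convex sets make sense. Next to a pole, points of analyticity
  would satisfy both |w| >= |w0| + 1 and |w - w0| < 1.\<close>

lemma nt_limit_no_poles:
  assumes "nt_limit w x0 w w0" "a > 0"
  obtains \<delta> where "\<delta> > 0" "\<And>z. z \<in> nontangential_sector x0 a \<Longrightarrow> cmod (z - of_real x0) < \<delta> \<Longrightarrow> z \<in> analyticity_domain w"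
proof -
  obtain \<delta> where \<delta>: "\<delta> > 0" "\<And>z. z \<in> analyticity_domain w \<inter> nontangential_sector x0 a \<Longrightarrow>
      cmod (z - of_real x0) < \<delta> \<Longrightarrow> cmod (w z - of_real w0) < 1"
    using assms(1)[unfolded nt_limit_iff, rule_format, OF assms(2), of 1] by auto
  show ?thesis
  proof (rule that[OF \<delta>(1)], rule ccontr)
    fix p assume p: "p \<in> nontangential_sector x0 a" "cmod (p - of_real x0) < \<delta>" "p \<notin> analyticity_domain w"
    then have pu: "p \<in> upper_half_plane" by (simp add: nontangential_sector_def)
    then have "is_pole w p" using p analytic_or_pole[OF pu] by (auto simp: analyticity_domain_def)
    then have "eventually (\<lambda>z. cmod (w z) \<ge> \<bar>w0\<bar> + 1) (at p)"
      by (simp add: is_pole_def filterlim_at_infinity[of 0])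
    moreover have "eventually (\<lambda>z. z \<in> nontangential_sector x0 a \<inter> ball (of_real x0) \<delta>) (at p)"
      using p by (intro eventually_at_in_open')
        (auto simp: open_Int open_nontangential_sector dist_norm norm_minus_commute)
    moreover note eventually_analyticity_domain[OF pu]
    ultimately have "eventually (\<lambda>z. False) (at p)"
    proof eventually_elim
      case (elim z)
      then have "cmod (w z - of_real w0) < 1"
        by (intro \<delta>(2)) (auto simp: dist_norm norm_minus_commute)
      then show ?case using elim(1) norm_triangle_ineq2[of "w z" "of_real w0"] by simp
    qed
    then show False by simp
  qed
qed

text \<open>Cauchy's estimate for the remainder \<open>g\<close> on a circle about \<open>z\<close>
  with radius \<open>Im z / 2\<close>. In a sector this radius is comparable with |z - x0|, so a
  remainder that is o(|z - x0|) has derivative o(1).\<close>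

lemma nt_deriv_limit_of_quotient:
  assumes q: "nt_limit w x0 (\<lambda>z. (w z - of_real w0) / (z - of_real x0)) d"
  shows "nt_limit w x0 (deriv w) d"
  unfolding nt_limit_iff
proof (intro allI impI)
  fix a e :: real assume a: "a > 0" and e: "e > 0"
  \<comment> \<open>The sector of aperture \<open>b\<close> contains the discs of radius
    \<open>Im z / 2\<close> about the points \<open>z\<close> of the given one: there |Re u - x0| <
    (2 a + 1) Im z / 2 and Im u >= Im z / 2.\<close>
  define b where "b = 2 * a + 1"
  \<comment> \<open>Makes Cauchy's bound \<open>\<epsilon> * (2 * (a + 2))\<close> equal to
    \<open>e / 2\<close>.\<close>
  define \<epsilon> where "\<epsilon> = e / (4 * (a + 2))"
  have b: "b > 0" and \<epsilon>: "\<epsilon> > 0" using a e by (simp_all add: b_def \<epsilon>_def)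
  obtain \<delta>1 where \<delta>1: "\<delta>1 > 0" "\<And>z. z \<in> nontangential_sector x0 b \<Longrightarrow>
      cmod (z - of_real x0) < \<delta>1 \<Longrightarrow> z \<in> analyticity_domain w"
    using nt_limit_no_poles[OF nt_limit_value_of_quotient[OF q] b] by blast
  obtain \<delta>2 where \<delta>2: "\<delta>2 > 0" "\<And>z. z \<in> analyticity_domain w \<inter> nontangential_sector x0 b \<Longrightarrow>
      cmod (z - of_real x0) < \<delta>2 \<Longrightarrow> cmod ((w z - of_real w0) / (z - of_real x0) - of_real d) < \<epsilon>"
    using q[unfolded nt_limit_iff, rule_format, OF b \<epsilon>] by auto
  \<comment> \<open>Halved because points of the disc are at most twice as far from
    \<open>x0\<close> as its centre.\<close>
  define \<delta> where "\<delta> = min \<delta>1 \<delta>2 / 2"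
  define g where "g z = w z - of_real w0 - of_real d * (z - of_real x0)" for z
  have "cmod (deriv w z - of_real d) < e"
    if z: "z \<in> analyticity_domain w \<inter> nontangential_sector x0 a" and zd: "cmod (z - of_real x0) < \<delta>" for z
  proof -
    have y: "Im z > 0" and zx: "\<bar>Re z - x0\<bar> < a * Im z" and zc: "cmod (z - of_real x0) \<le> (a + 1) * Im z"
      using nontangential_sectorD[of z x0 a] z by blast+
    define R where "R = Im z / 2"
    have R: "R > 0" using y by (simp add: R_def)
    have near: "u \<in> analyticity_domain w \<inter> nontangential_sector x0 b" "cmod (u - of_real x0) \<le> 2 * (a + 2) * R"
      "cmod (u - of_real x0) < \<delta>2"
      if u: "u \<in> cball z R" for u
    proof -
      have uz: "cmod (u - z) \<le> R" using u by (simp add: dist_norm norm_minus_commute)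
      have imu: "Im u \<ge> Im z / 2" using abs_Im_le_cmod[of "u - z"] uz by (simp add: R_def)
      have "\<bar>Re u - x0\<bar> \<le> \<bar>Re z - x0\<bar> + R" using abs_Re_le_cmod[of "u - z"] uz by simp
      also have "\<dots> < a * Im z + Im z / 2" using zx by (simp add: R_def)
      also have "\<dots> = b * (Im z / 2)" by (simp add: b_def algebra_simps)
      also have "\<dots> \<le> b * Im u" using imu b by (intro mult_left_mono) auto
      finally have us: "u \<in> nontangential_sector x0 b"
        using imu y by (simp add: nontangential_sector_def upper_half_plane_def)
      have tri: "cmod (u - of_real x0) \<le> cmod (z - of_real x0) + R"
        using norm_triangle_ineq[of "u - z" "z - of_real x0"] uz by simp
      also have "R \<le> cmod (z - of_real x0)"
        using abs_Im_le_cmod[of "z - of_real x0"] y by (simp add: R_def)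
      finally have "cmod (u - of_real x0) < 2 * \<delta>" using zd by simp
      then have lt: "cmod (u - of_real x0) < \<delta>1" "cmod (u - of_real x0) < \<delta>2" by (simp_all add: \<delta>_def)
      then show "u \<in> analyticity_domain w \<inter> nontangential_sector x0 b" "cmod (u - of_real x0) < \<delta>2"
        using \<delta>1(2)[OF us] us by auto
      have "cmod (u - of_real x0) \<le> (a + 1) * Im z + R" using tri zc by simp
      also have "\<dots> \<le> 2 * (a + 2) * R" using y a by (simp add: R_def algebra_simps)
      finally show "cmod (u - of_real x0) \<le> 2 * (a + 2) * R" .
    qed
    have an: "w analytic_on cball z R"
      using near(1) by (subst analytic_on_analytic_at) (auto simp: analyticity_domain_def)
    then have hol: "g holomorphic_on cball z R"
      unfolding g_def by (intro holomorphic_intros analytic_imp_holomorphic)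
    have "cmod ((deriv ^^ 1) g z) \<le> fact 1 * (\<epsilon> * (2 * (a + 2) * R)) / R ^ 1"
    proof (rule Cauchy_inequality[OF _ _ R])
      show "g holomorphic_on ball z R" using hol ball_subset_cball by (rule holomorphic_on_subset)
      show "continuous_on (cball z R) g" using hol by (rule holomorphic_on_imp_continuous_on)
      fix u assume "cmod (z - u) = R"
      then have u: "u \<in> cball z R" by (simp add: dist_norm)
      have ux: "u \<noteq> of_real x0" using near(1)[OF u] nontangential_sectorD(1)[of u x0 b] by auto
      have "(w u - of_real w0) / (u - of_real x0) * (u - of_real x0) = w u - of_real w0" using ux by simp
      then have "g u = ((w u - of_real w0) / (u - of_real x0) - of_real d) * (u - of_real x0)"
        unfolding g_def by (subst left_diff_distrib) simp
      then have "cmod (g u) = cmod ((w u - of_real w0) / (u - of_real x0) - of_real d) * cmod (u - of_real x0)"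
        by (simp only: norm_mult)
      also have "\<dots> \<le> \<epsilon> * (2 * (a + 2) * R)"
        using \<delta>2(2)[OF near(1)[OF u] near(3)[OF u]] near(2)[OF u] \<epsilon> by (intro mult_mono) auto
      finally show "cmod (g u) \<le> \<epsilon> * (2 * (a + 2) * R)" .
    qed
    then have "cmod (deriv g z) \<le> \<epsilon> * (2 * (a + 2))" using R by simp
    also have "\<dots> = e / 2" using a by (simp add: \<epsilon>_def field_simps)
    also have "\<dots> < e" using e by simp
    also have "deriv g z = deriv w z - of_real d"
    proof -
      have "w analytic_on {z}" using z by (simp add: analyticity_domain_def)
      then have "w field_differentiable at z" using analytic_on_imp_differentiable_at by blast
      then have "(w has_field_derivative deriv w z) (at z)"
        by (simp add: field_differentiable_derivI)
      then have "(g has_field_derivative deriv w z - of_real d) (at z)"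
        unfolding g_def by (auto intro!: derivative_eq_intros)
      then show ?thesis by (rule DERIV_imp_deriv)
    qed
    finally show ?thesis .
  qed
  moreover have "\<delta> > 0" using \<delta>1(1) \<delta>2(1) by (simp add: \<delta>_def)
  ultimately show "\<exists>\<delta>>0. \<forall>z\<in>analyticity_domain w \<inter> nontangential_sector x0 a.
      cmod (z - of_real x0) < \<delta> \<longrightarrow> cmod (deriv w z - of_real d) < e" by blast
qed

text \<open>Near \<open>x0\<close> in the sector the derivative of w(z) - d z is smaller than e / 2,
  so by convexity the function is Lipschitz with this constant. Letting the second point tend to
  \<open>x0\<close> within the sector replaces its value by the boundary value.\<close>

lemma nt_quotient_limit_of_deriv:
  assumes w0: "nt_limit w x0 w w0" and w1: "nt_limit w x0 (deriv w) d"
  shows "nt_limit w x0 (\<lambda>z. (w z - of_real w0) / (z - of_real x0)) d"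
  unfolding nt_limit_iff
proof (intro allI impI)
  fix a e :: real assume a: "a > 0" and e: "e > 0"
  obtain \<delta>1 where \<delta>1: "\<delta>1 > 0" "\<And>z. z \<in> nontangential_sector x0 a \<Longrightarrow>
      cmod (z - of_real x0) < \<delta>1 \<Longrightarrow> z \<in> analyticity_domain w"
    using nt_limit_no_poles[OF w0 a] by blast
  have "e / 2 > 0" using e by simp
  then obtain \<delta>2 where \<delta>2: "\<delta>2 > 0" "\<And>z. z \<in> analyticity_domain w \<inter> nontangential_sector x0 a \<Longrightarrow>
      cmod (z - of_real x0) < \<delta>2 \<Longrightarrow> cmod (deriv w z - of_real d) < e / 2"
    using w1[unfolded nt_limit_iff, rule_format, OF a, of "e / 2"] by auto
  define \<delta> where "\<delta> = min \<delta>1 \<delta>2"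
  have \<delta>: "\<delta> > 0" using \<delta>1 \<delta>2 by (simp add: \<delta>_def)
  define K where "K = nontangential_sector x0 a \<inter> ball (of_real x0) \<delta>"
  define g where "g z = w z - of_real d * z" for z
  have conv: "convex K" unfolding K_def by (intro convex_Int convex_nontangential_sector convex_ball)
  have K: "u \<in> analyticity_domain w \<inter> nontangential_sector x0 a" "cmod (deriv w u - of_real d) < e / 2"
    if "u \<in> K" for u
    using that \<delta>1(2)[of u] \<delta>2(2)[of u] by (auto simp: K_def \<delta>_def dist_norm norm_minus_commute)
  have der: "(g has_field_derivative (deriv w u - of_real d)) (at u within K)" if "u \<in> K" for u
  proof -
    have "w analytic_on {u}" using K(1)[OF that] by (simp add: analyticity_domain_def)
    then have "w field_differentiable at u" using analytic_on_imp_differentiable_at by blast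
    then have "(w has_field_derivative deriv w u) (at u)" by (simp add: field_differentiable_derivI)
    then have "(g has_field_derivative deriv w u - of_real d) (at u)"
      unfolding g_def by (auto intro!: derivative_eq_intros)
    then show ?thesis by (rule has_field_derivative_at_within)
  qed
  have lip: "cmod (g u - g v) \<le> e / 2 * cmod (u - v)" if "u \<in> K" "v \<in> K" for u v
    by (rule field_differentiable_bound[where f' = "\<lambda>u. deriv w u - of_real d" and S = K])
      (use K(2) conv der that in \<open>auto intro: less_imp_le\<close>)
  let ?G = "at (complex_of_real x0) within (analyticity_domain w \<inter> nontangential_sector x0 a)"
  have "cmod ((w z - of_real w0) / (z - of_real x0) - of_real d) < e"
    if z: "z \<in> analyticity_domain w \<inter> nontangential_sector x0 a" and zd: "cmod (z - of_real x0) < \<delta>" for z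
  proof -
    have zK: "z \<in> K" using z zd by (simp add: K_def dist_norm norm_minus_commute)
    have zx: "z \<noteq> of_real x0" using z nontangential_sectorD(1)[of z x0 a] by auto
    have "cmod (g z - (of_real w0 - of_real d * of_real x0)) \<le> e / 2 * cmod (z - of_real x0)"
    proof (rule tendsto_le[OF nt_filter_nontrivial[OF a]])
      show "((\<lambda>v. e / 2 * cmod (z - v)) \<longlongrightarrow> e / 2 * cmod (z - of_real x0)) ?G"
        by (intro tendsto_intros)
      have "(w \<longlongrightarrow> of_real w0) ?G" using w0 a by (simp add: nt_limit_def)
      then show "((\<lambda>v. cmod (g z - g v)) \<longlongrightarrow> cmod (g z - (of_real w0 - of_real d * of_real x0))) ?G"
        unfolding g_def by (intro tendsto_intros)
      have "eventually (\<lambda>v. v \<in> K) ?G"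
        unfolding eventually_at using \<delta> by (auto simp: K_def dist_commute intro!: exI[of _ \<delta>])
      then show "\<forall>\<^sub>F v in ?G. cmod (g z - g v) \<le> e / 2 * cmod (z - v)"
        by eventually_elim (rule lip[OF zK])
    qed
    moreover have "(w z - of_real w0) / (z - of_real x0) - of_real d =
        (g z - (of_real w0 - of_real d * of_real x0)) / (z - of_real x0)"
      using zx by (simp add: g_def field_simps)
    ultimately have "cmod ((w z - of_real w0) / (z - of_real x0) - of_real d) \<le> e / 2"
      using zx by (simp add: norm_divide divide_le_eq)
    then show ?thesis using e by simp
  qed
  then show "\<exists>\<delta>>0. \<forall>z\<in>analyticity_domain w \<inter> nontangential_sector x0 a. cmod (z - of_real x0) < \<delta> \<longrightarrow>
      cmod ((w z - of_real w0) / (z - of_real x0) - of_real d) < e" using \<delta> by blast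
qed

end

section \<open>The lower limit of the kernel\<close>

lemma half_disc_subset: "half_disc x0 r \<subseteq> upper_half_plane"
  by (auto simp: half_disc_def upper_half_plane_def)

lemma kernel_liminf_eq:
  "kernel_liminf w x0 = Liminf (at (complex_of_real x0) within analyticity_domain w) (\<lambda>z. ereal (Im (w z) / Im z))"
  unfolding kernel_liminf_def
proof (rule Liminf_eq)
  show "\<forall>\<^sub>F z in at (complex_of_real x0) within analyticity_domain w.
      ereal (Re (nevanlinna_kernel w z z)) = ereal (Im (w z) / Im z)"
    unfolding eventually_at_filter
    by (rule always_eventually)
      (auto simp: nevanlinna_kernel_diagonal analyticity_domain_def upper_half_plane_def)
qed

context
  fixes w :: "complex \<Rightarrow> complex" and x0 :: real
  assumes w: "w nicely_meromorphic_on upper_half_plane"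
begin

lemma analytic_or_pole_minus_linear:
  assumes "z \<in> upper_half_plane"
  shows "(\<lambda>z. w z - of_real c * z) analytic_on {z} \<longleftrightarrow> w analytic_on {z}"
    "(\<lambda>z. w z - of_real c * z) analytic_on {z} \<or> is_pole (\<lambda>z. w z - of_real c * z) z"
proof -
  have "w analytic_on {z}" if "(\<lambda>z. w z - of_real c * z) analytic_on {z}"
  proof -
    have "(\<lambda>u. of_real c * u) analytic_on {z}" by (intro analytic_intros)
    from analytic_on_add[OF that this]
    have "(\<lambda>u. (w u - of_real c * u) + of_real c * u) analytic_on {z}" .
    then show ?thesis by simp
  qed
  moreover have "(\<lambda>z. w z - of_real c * z) analytic_on {z}" if "w analytic_on {z}"
    using that by (intro analytic_intros)
  ultimately show *: "(\<lambda>z. w z - of_real c * z) analytic_on {z} \<longleftrightarrow> w analytic_on {z}" by blast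
  have "is_pole (\<lambda>z. w z - of_real c * z) z" if "is_pole w z"
  proof -
    have "((\<lambda>u. - of_real c * u) \<longlongrightarrow> - of_real c * z) (at z)" by (intro tendsto_intros)
    from tendsto_add_filterlim_at_infinity[OF this that[unfolded is_pole_def]]
    show ?thesis by (simp add: is_pole_def)
  qed
  then show "(\<lambda>z. w z - of_real c * z) analytic_on {z} \<or> is_pole (\<lambda>z. w z - of_real c * z) z"
    using analytic_or_pole[OF w assms] * by blast
qed

text \<open>Schwarz-Pick for w(z) - c z, divided by \<open>Im s\<close>. What degenerates as
  \<open>s\<close> tends to \<open>x0\<close> then appears only as the kernel value at
  \<open>s\<close> minus \<open>c\<close>, and the limit of the inequality is Julia's.\<close>

lemma schwarz_pick_minus_linear:
  assumes r: "r > 0"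
    and Im: "\<And>z. z \<in> analyticity_domain w \<inter> half_disc x0 r \<Longrightarrow> Im (w z) \<ge> c * Im z"
    and z: "z \<in> analyticity_domain w \<inter> half_disc x0 (r / 2)"
    and s: "s \<in> analyticity_domain w \<inter> half_disc x0 (r / 2)"
  shows "Im z * (cmod ((w z - of_real c * z) - cnj (w s - of_real c * s)))\<^sup>2 \<le>
    4 * (cmod (z - cnj s))\<^sup>2 * (Im (w z) - c * Im z) * (Im (w s) / Im s - c)"
proof -
  define F where "F z = w z - of_real c * z" for z
  have sub: "half_disc x0 r \<subseteq> upper_half_plane" by (rule half_disc_subset)
  have "w meromorphic_on half_disc x0 r"
    using w meromorphic_on_subset[OF _ sub] by (simp add: nicely_meromorphic_on_def)
  then have F: "F meromorphic_on half_disc x0 r"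
    unfolding F_def by (intro meromorphic_intros)
  have an: "F analytic_on {z} \<longleftrightarrow> w analytic_on {z}" if "z \<in> upper_half_plane" for z
    unfolding F_def by (rule analytic_or_pole_minus_linear(1)[OF that])
  have ImF: "Im (F z) = Im (w z) - c * Im z" for z by (simp add: F_def)
  have y: "Im s > 0" using s by (simp add: half_disc_def)
  have "Im z * Im s * (cmod (F z - cnj (F s)))\<^sup>2 \<le> 4 * (cmod (z - cnj s))\<^sup>2 * (Im (F z) * Im (F s))"
  proof (rule schwarz_pick_upper_half_plane[OF r F])
    show "F analytic_on {z} \<or> is_pole F z" if "z \<in> half_disc x0 r" for z
      unfolding F_def using analytic_or_pole_minus_linear(2) that sub by blast
    show "Im (F z) \<ge> 0" if "z \<in> half_disc x0 r" "F analytic_on {z}" for z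
      using Im[of z] that an sub by (auto simp: ImF analyticity_domain_def)
    show "z \<in> half_disc x0 (r / 2)" "s \<in> half_disc x0 (r / 2)" using z s by auto
    show "F analytic_on {z}" "F analytic_on {s}" using z s an by (auto simp: analyticity_domain_def)
  qed
  moreover have "Im (F s) = Im s * (Im (w s) / Im s - c)"
    using y by (simp add: ImF right_diff_distrib)
  ultimately have "Im s * (Im z * (cmod (F z - cnj (F s)))\<^sup>2) \<le>
      Im s * (4 * (cmod (z - cnj s))\<^sup>2 * (Im (w z) - c * Im z) * (Im (w s) / Im s - c))"
    by (simp only: ImF[of z] mult_ac)
  then show ?thesis using y unfolding F_def by (simp only: mult_le_cancel_left_pos)
qed

text \<open>Subtracting \<open>(d - \<epsilon>) z\<close> leaves a function with nonnegative imaginary part near \<open>x0\<close> whose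
  kernel has lower limit \<open>\<epsilon>\<close>, so that Julia's inequality bounds its difference quotient by a
  multiple of \<open>\<epsilon>\<close>.\<close>

lemma nt_quotient_limit_of_kernel_liminf:
  assumes d: "kernel_liminf w x0 = ereal d"
  obtains w0 where "nt_limit w x0 (\<lambda>z. (w z - of_real w0) / (z - of_real x0)) d"
proof -
  define \<rho> where "\<rho> = analyticity_domain w"
  define k where "k z = Im (w z) / Im z" for z
  let ?G = "at (complex_of_real x0) within \<rho>"
  have lim: "Liminf ?G (\<lambda>z. ereal (k z)) = ereal d"
    using d unfolding kernel_liminf_eq \<rho>_def k_def .
  have \<rho>_pos: "Im z > 0" if "z \<in> \<rho>" for z
    using that by (auto simp: \<rho>_def analyticity_domain_def upper_half_plane_def)
  have low: "\<exists>r>0. \<forall>z\<in>\<rho> \<inter> half_disc x0 r. Im (w z) \<ge> (d - e) * Im z" if e: "e > 0" for e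
  proof -
    have "\<forall>y<ereal d. eventually (\<lambda>z. y < ereal (k z)) ?G"
      using le_Liminf_iff[of "ereal d" ?G "\<lambda>z. ereal (k z)"] lim by simp
    moreover have "ereal (d - e) < ereal d" using e by simp
    ultimately have "eventually (\<lambda>z. ereal (d - e) < ereal (k z)) ?G" by blast
    then obtain r where r: "r > 0" "\<And>z. z \<in> \<rho> \<Longrightarrow> z \<noteq> of_real x0 \<Longrightarrow> cmod (z - of_real x0) < r \<Longrightarrow> d - e < k z"
      unfolding eventually_at dist_norm by auto
    have "Im (w z) \<ge> (d - e) * Im z" if "z \<in> \<rho> \<inter> half_disc x0 r" for z
    proof -
      have "d - e < k z" using that \<rho>_pos[of z] by (intro r(2)) (auto simp: half_disc_def)
      then show ?thesis using \<rho>_pos[of z] that by (auto simp: k_def pos_less_divide_eq)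
    qed
    then show ?thesis using r(1) by blast
  qed
  \<comment> \<open>Otherwise the lower limit would be at least \<open>d + e\<close>. The points
    found here may approach \<open>x0\<close> tangentially.\<close>
  have "\<exists>s\<in>\<rho>. cmod (s - of_real x0) < e \<and> k s < d + e" if e: "e > 0" for e
  proof (rule ccontr)
    assume no: "\<not> (\<exists>s\<in>\<rho>. cmod (s - of_real x0) < e \<and> k s < d + e)"
    have "eventually (\<lambda>z. ereal (d + e) \<le> ereal (k z)) ?G"
      unfolding eventually_at dist_norm using e no by (intro exI[of _ e]) auto
    then have "ereal (d + e) \<le> Liminf ?G (\<lambda>z. ereal (k z))" by (rule Liminf_bounded)
    then show False using lim e by simp
  qed
  then have "\<forall>n. \<exists>s\<in>\<rho>. cmod (s - of_real x0) < 1 / real (Suc n) \<and> k s < d + 1 / real (Suc n)" by simp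
  then obtain s where s: "\<And>n. s n \<in> \<rho>" "\<And>n. cmod (s n - of_real x0) < 1 / real (Suc n)"
    "\<And>n. k (s n) < d + 1 / real (Suc n)" by metis
  have s_lim: "s \<longlonglongrightarrow> of_real x0"
  proof (rule LIM_zero_cancel, rule Lim_null_comparison)
    show "\<forall>\<^sub>F n in sequentially. cmod (s n - of_real x0) \<le> 1 / real (Suc n)"
      using s(2) by (intro always_eventually allI less_imp_le)
    show "(\<lambda>n. 1 / real (Suc n)) \<longlonglongrightarrow> 0" by (rule LIMSEQ_Suc[OF lim_1_over_n])
  qed
  have ev_disc: "eventually (\<lambda>n. s n \<in> \<rho> \<inter> half_disc x0 r) sequentially" if "r > 0" for r
  proof -
    have "eventually (\<lambda>n. dist (s n) (of_real x0) < r) sequentially" using s_lim that by (rule tendstoD)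
    then show ?thesis by eventually_elim (use s(1) \<rho>_pos in \<open>auto simp: half_disc_def dist_norm\<close>)
  qed
  have k_lim: "(\<lambda>n. k (s n)) \<longlonglongrightarrow> d"
  proof (rule order_tendstoI)
    fix c assume "c < d"
    then obtain r where r: "r > 0" "\<forall>z\<in>\<rho> \<inter> half_disc x0 r. Im (w z) \<ge> (d - (d - c) / 2) * Im z"
      using low[of "(d - c) / 2"] by auto
    from ev_disc[OF r(1)] show "eventually (\<lambda>n. c < k (s n)) sequentially"
    proof eventually_elim
      case (elim n)
      then have "k (s n) \<ge> d - (d - c) / 2"
        using r(2) \<rho>_pos[OF s(1)[of n]] by (auto simp: k_def pos_le_divide_eq)
      moreover have "d - (d - c) / 2 > c" using \<open>c < d\<close> by (simp add: field_simps)
      ultimately show ?case by linarith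
    qed
  next
    fix c assume "d < c"
    have "(\<lambda>n. d + 1 / real (Suc n)) \<longlonglongrightarrow> d + 0"
      by (intro tendsto_intros LIMSEQ_Suc[OF lim_1_over_n])
    then have "eventually (\<lambda>n. d + 1 / real (Suc n) < c) sequentially"
      using order_tendstoD(2)[of _ "d + 0" sequentially c] \<open>d < c\<close> by simp
    then show "eventually (\<lambda>n. k (s n) < c) sequentially"
      by eventually_elim (use s(3) less_trans in blast)
  qed
  have julia: "Im z * (cmod ((w z - of_real c * z) - cnj (w (s n) - of_real c * s n)))\<^sup>2 \<le>
      4 * (cmod (z - cnj (s n)))\<^sup>2 * (Im (w z) - c * Im z) * (k (s n) - c)"
    if "r > 0" "\<forall>z\<in>\<rho> \<inter> half_disc x0 r. Im (w z) \<ge> c * Im z" "z \<in> \<rho> \<inter> half_disc x0 (r / 2)"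
      "s n \<in> \<rho> \<inter> half_disc x0 (r / 2)" for z c r n
    using schwarz_pick_minus_linear[of r c z "s n"] that unfolding \<rho>_def k_def by blast
  \<comment> \<open>With one point \<open>z\<close> fixed, Schwarz-Pick confines the values
    \<open>w (s n)\<close> to a bounded set because \<open>k (s n)\<close> converges. A convergent
    subsequence supplies the candidate for the boundary value; the slope d - 1 is just some number
    below \<open>d\<close>.\<close>
  obtain w0 :: complex and h where h: "strict_mono h" "(\<lambda>n. w (s (h n))) \<longlonglongrightarrow> w0"
  proof -
    define c where "c = d - 1"
    obtain r where r: "r > 0" "\<forall>z\<in>\<rho> \<inter> half_disc x0 r. Im (w z) \<ge> c * Im z"
      using low[of 1] by (auto simp: c_def)
    obtain z where z: "z \<in> \<rho> \<inter> half_disc x0 (r / 2)"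
      using eventually_happens[OF ev_disc[of "r / 2"]] r(1) by auto
    have y: "Im z > 0" using z \<rho>_pos by blast
    let ?L = "\<lambda>n. w (s n) - of_real c * s n"
    define M where "M = sqrt (4 * (cmod (z - cnj (of_real x0)))\<^sup>2 * (Im (w z) - c * Im z) * (d - c) / Im z + 1)"
    have "(\<lambda>n. 4 * (cmod (z - cnj (s n)))\<^sup>2 * (Im (w z) - c * Im z) * (k (s n) - c) / Im z) \<longlonglongrightarrow>
        4 * (cmod (z - cnj (of_real x0)))\<^sup>2 * (Im (w z) - c * Im z) * (d - c) / Im z"
      by (intro tendsto_intros s_lim k_lim) (use y in simp)
    then have "eventually (\<lambda>n. 4 * (cmod (z - cnj (s n)))\<^sup>2 * (Im (w z) - c * Im z) * (k (s n) - c) / Im z <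
        4 * (cmod (z - cnj (of_real x0)))\<^sup>2 * (Im (w z) - c * Im z) * (d - c) / Im z + 1) sequentially"
      by (rule order_tendstoD) simp
    moreover have "eventually (\<lambda>n. s n \<in> \<rho> \<inter> half_disc x0 (r / 2)) sequentially"
      using ev_disc[of "r / 2"] r(1) by simp
    moreover have "eventually (\<lambda>n. dist (s n) (of_real x0) < 1) sequentially"
      using s_lim by (rule tendstoD) simp
    ultimately have "eventually (\<lambda>n. cmod (w (s n)) \<le>
        M + cmod (w z - of_real c * z) + \<bar>c\<bar> * (1 + \<bar>x0\<bar>)) sequentially"
    proof eventually_elim
      case (elim n)
      have "(cmod ((w z - of_real c * z) - cnj (?L n)))\<^sup>2 \<le>
          4 * (cmod (z - cnj (s n)))\<^sup>2 * (Im (w z) - c * Im z) * (k (s n) - c) / Im z"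
        using julia[OF r z elim(2)] y by (simp add: field_simps)
      then have "cmod ((w z - of_real c * z) - cnj (?L n)) \<le> M"
        unfolding M_def using elim(1) by (intro real_le_rsqrt) linarith
      then have L: "cmod (?L n) \<le> M + cmod (w z - of_real c * z)"
        using norm_triangle_ineq2[of "cnj (?L n)" "w z - of_real c * z"]
        by (simp only: complex_mod_cnj norm_minus_commute)
      have "cmod (s n) \<le> 1 + \<bar>x0\<bar>"
        using elim(3) norm_triangle_ineq2[of "s n" "of_real x0"] by (simp add: dist_norm)
      then have "cmod (of_real c * s n) \<le> \<bar>c\<bar> * (1 + \<bar>x0\<bar>)"
        by (simp only: norm_mult norm_of_real) (intro mult_left_mono, auto)
      then show ?case using L norm_triangle_ineq[of "?L n" "of_real c * s n"] by simp
    qed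
    then have "Bfun (\<lambda>n. w (s n)) sequentially" by (rule BfunI)
    then have "bounded (range (\<lambda>n. w (s n)))" by (simp add: Bseq_eq_bounded)
    from bounded_imp_convergent_subsequence[OF this] obtain l h where
      "strict_mono (h :: nat \<Rightarrow> nat)" "((\<lambda>n. w (s n)) \<circ> h) \<longlonglongrightarrow> l" by blast
    then show ?thesis using that by (simp add: comp_def)
  qed
  have sh: "(\<lambda>n. s (h n)) \<longlonglongrightarrow> of_real x0" and kh: "(\<lambda>n. k (s (h n))) \<longlonglongrightarrow> d"
    using LIMSEQ_subseq_LIMSEQ[OF s_lim h(1)] LIMSEQ_subseq_LIMSEQ[OF k_lim h(1)] by (simp_all add: comp_def)
  \<comment> \<open>The kernel values stay bounded while the imaginary parts of the points tend to
    0, which makes the boundary value real.\<close>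
  have "(\<lambda>n. Im (w (s (h n)))) \<longlonglongrightarrow> Im w0" by (intro tendsto_intros h(2))
  moreover have "(\<lambda>n. k (s (h n)) * Im (s (h n))) \<longlonglongrightarrow> d * Im (of_real x0)"
    by (intro tendsto_intros sh kh)
  moreover have "k (s n) * Im (s n) = Im (w (s n))" for n using \<rho>_pos[OF s(1)[of n]] by (simp add: k_def)
  ultimately have "Im w0 = 0" using LIMSEQ_unique by fastforce
  then have w0: "w0 = of_real (Re w0)" by (simp add: complex_eq_iff)
  have "nt_limit w x0 (\<lambda>z. (w z - of_real (Re w0)) / (z - of_real x0)) d"
    unfolding nt_limit_iff
  proof (intro allI impI)
    fix a e :: real assume a: "a > 0" and e: "e > 0"
    \<comment> \<open>Julia's inequality yields the slope \<open>c\<close> up to an error 4 (a + 1)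
      \<open>\<epsilon>\<close>, and \<open>c\<close> differs from \<open>d\<close> by
      \<open>\<epsilon>\<close>; the surplus makes the final inequality strict.\<close>
    define \<epsilon> where "\<epsilon> = e / (4 * (a + 1) + 2)"
    have \<epsilon>: "\<epsilon> > 0" using a e by (simp add: \<epsilon>_def)
    define c where "c = d - \<epsilon>"
    obtain r where r: "r > 0" "\<forall>z\<in>\<rho> \<inter> half_disc x0 r. Im (w z) \<ge> c * Im z"
      using low[OF \<epsilon>] by (auto simp: c_def)
    have "cmod ((w z - of_real (Re w0)) / (z - of_real x0) - of_real d) < e"
      if z: "z \<in> analyticity_domain w \<inter> nontangential_sector x0 a" and zr: "cmod (z - of_real x0) < r / 2" for z
    proof -
      have y: "Im z > 0" and zc: "cmod (z - of_real x0) \<le> (a + 1) * Im z"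
        using nontangential_sectorD[of z x0 a] z by blast+
      have zx: "z \<noteq> of_real x0" using y by auto
      have zm: "z \<in> \<rho> \<inter> half_disc x0 (r / 2)" using z zr y by (simp add: \<rho>_def half_disc_def)
      define F0 where "F0 = w0 - of_real c * of_real x0"
      define E where "E = w z - of_real c * z - F0"
      define t where "t = cmod (z - of_real x0)"
      have t: "t > 0" using zx by (simp add: t_def)
      have F0: "cnj F0 = F0" by (subst (1 2) F0_def, subst (1 2) w0) simp
      have "Im z * (cmod ((w z - of_real c * z) - cnj F0))\<^sup>2 \<le>
          4 * (cmod (z - cnj (of_real x0)))\<^sup>2 * (Im (w z) - c * Im z) * (d - c)"
      proof (rule tendsto_le[OF sequentially_bot])
        show "(\<lambda>n. 4 * (cmod (z - cnj (s (h n))))\<^sup>2 * (Im (w z) - c * Im z) * (k (s (h n)) - c)) \<longlonglongrightarrow>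
            4 * (cmod (z - cnj (of_real x0)))\<^sup>2 * (Im (w z) - c * Im z) * (d - c)"
          by (intro tendsto_intros sh kh)
        show "(\<lambda>n. Im z * (cmod ((w z - of_real c * z) - cnj (w (s (h n)) - of_real c * s (h n))))\<^sup>2) \<longlonglongrightarrow>
            Im z * (cmod ((w z - of_real c * z) - cnj F0))\<^sup>2"
          unfolding F0_def by (intro tendsto_intros sh h(2))
        have "eventually (\<lambda>n. s (h n) \<in> \<rho> \<inter> half_disc x0 (r / 2)) sequentially"
          using eventually_subseq[OF h(1) ev_disc[of "r / 2"]] r(1) by simp
        then show "\<forall>\<^sub>F n in sequentially. Im z * (cmod ((w z - of_real c * z) - cnj (w (s (h n)) - of_real c * s (h n))))\<^sup>2
            \<le> 4 * (cmod (z - cnj (s (h n))))\<^sup>2 * (Im (w z) - c * Im z) * (k (s (h n)) - c)"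
          by eventually_elim (rule julia[OF r zm])
      qed
      then have "Im z * (cmod E)\<^sup>2 \<le> 4 * t\<^sup>2 * (Im (w z) - c * Im z) * \<epsilon>"
        by (simp add: F0 E_def t_def c_def)
      also have "Im (w z) - c * Im z = Im E" using F0 by (simp add: E_def complex_eq_iff)
      \<comment> \<open>Replacing \<open>Im E\<close> by |E| allows division by |E|, and the sector
        exchanges one factor \<open>t\<close> for a multiple of \<open>Im z\<close>. This leaves |E|
        bounded by a multiple of \<open>\<epsilon> * t\<close>.\<close>
      also have "4 * t\<^sup>2 * Im E * \<epsilon> \<le> 4 * t\<^sup>2 * cmod E * \<epsilon>"
        using \<epsilon> abs_Im_le_cmod[of E] by (intro mult_right_mono mult_left_mono) auto
      finally have "cmod E * (Im z * cmod E) \<le> cmod E * (4 * t\<^sup>2 * \<epsilon>)"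
        by (simp add: power2_eq_square mult_ac)
      then have "Im z * cmod E \<le> 4 * t\<^sup>2 * \<epsilon>"
        using \<epsilon> by (cases "E = 0") (auto simp: mult_le_cancel_left)
      also have "4 * t\<^sup>2 * \<epsilon> \<le> 4 * (t * ((a + 1) * Im z)) * \<epsilon>"
        using zc \<epsilon> t unfolding power2_eq_square by (intro mult_right_mono mult_left_mono) (auto simp: t_def)
      finally have "Im z * cmod E \<le> Im z * (4 * (a + 1) * \<epsilon> * t)" by (simp add: mult_ac)
      then have Et: "cmod E \<le> 4 * (a + 1) * \<epsilon> * t" using y by simp
      have "w z - of_real (Re w0) = E + of_real c * (z - of_real x0)"
        using w0 by (simp add: E_def F0_def algebra_simps)
      then have "(w z - of_real (Re w0)) / (z - of_real x0) - of_real d = E / (z - of_real x0) - of_real \<epsilon>"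
        using zx by (simp add: add_divide_distrib c_def)
      then have "cmod ((w z - of_real (Re w0)) / (z - of_real x0) - of_real d) \<le> cmod E / t + \<epsilon>"
        using norm_triangle_ineq4[of "E / (z - of_real x0)" "of_real \<epsilon>"] \<epsilon> by (simp add: norm_divide t_def)
      also have "\<dots> \<le> 4 * (a + 1) * \<epsilon> + \<epsilon>" using Et t by (simp add: divide_le_eq)
      also have "\<dots> < (4 * (a + 1) + 2) * \<epsilon>" using \<epsilon> by (simp add: algebra_simps)
      also have "\<dots> = e" using a by (simp add: \<epsilon>_def)
      finally show ?thesis .
    qed
    then show "\<exists>\<delta>>0. \<forall>z\<in>analyticity_domain w \<inter> nontangential_sector x0 a. cmod (z - of_real x0) < \<delta> \<longrightarrow>
        cmod ((w z - of_real (Re w0)) / (z - of_real x0) - of_real d) < e" using r(1) by (intro exI[of _ "r / 2"]) auto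
  qed
  then show ?thesis using that by blast
qed

end

text \<open>The bound \<open>Im w \<ge> - C y (1 + |w|\<^sup>2)\<close> makes the Cayley transform of \<open>w\<close>, multiplied by
  \<open>exp (4 i C (z - x0))\<close>, bounded by \<open>1\<close> near \<open>x0\<close>. By Julia's inequality it stays close to its
  boundary value wherever \<open>Im w \<le> 0\<close>, so \<open>w\<close> is bounded there.\<close>

lemma kernel_bounded_below_of_nt_limits:
  assumes w: "w nicely_meromorphic_on upper_half_plane"
    and C: "C \<ge> 0" "\<And>z. z \<in> analyticity_domain w \<Longrightarrow> - C * Im z * (1 + (cmod (w z))\<^sup>2) \<le> Im (w z)"
    and w0: "nt_limit w x0 w w0" and dt: "nt_limit w x0 (\<lambda>z. nevanlinna_kernel w z z) dt"
  obtains M where "\<forall>\<^sub>F z in at (complex_of_real x0) within analyticity_domain w. M \<le> Im (w z) / Im z"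
proof -
  define \<rho> where "\<rho> = analyticity_domain w"
  \<comment> \<open>With this radius 4 C Im z <= 1 on the half disc, which rules out the value
    \<open>- \<i>\<close> and is used again in the bound on \<open>S\<close>.\<close>
  define r where "r = 1 / (4 * C + 4)"
  have r: "r > 0" using C(1) by (simp add: r_def)
  have Cr: "4 * (C * r) \<le> 1" using C(1) by (simp add: r_def field_simps)
  have Cy: "4 * (C * Im z) \<le> 1" "C * Im z \<ge> 0" "Im z > 0" if "z \<in> half_disc x0 r" for z
  proof -
    show pos: "Im z > 0" using that by (simp add: half_disc_def)
    then show "C * Im z \<ge> 0" using C(1) by simp
    have "Im z \<le> r" using that abs_Im_le_cmod[of "z - of_real x0"] by (simp add: half_disc_def)
    then have "C * Im z \<le> C * r" using C(1) by (rule mult_left_mono)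
    then show "4 * (C * Im z) \<le> 1" using Cr by linarith
  qed
  have \<rho>_iff: "z \<in> \<rho> \<longleftrightarrow> w analytic_on {z}" if "z \<in> half_disc x0 r" for z
    using that half_disc_subset by (auto simp: \<rho>_def analyticity_domain_def)
  have \<rho>_pos: "Im z > 0" if "z \<in> \<rho>" for z
    using that by (auto simp: \<rho>_def analyticity_domain_def upper_half_plane_def)
  have ne: "w z \<noteq> - \<i>" if "z \<in> half_disc x0 r" "z \<in> \<rho>" for z
  proof
    assume "w z = - \<i>"
    then show False using C(2)[of z] that(2) Cy(1)[OF that(1)] by (simp add: \<rho>_def)
  qed
  define S where "S z = (if w analytic_on {z} then (w z - \<i>) / (w z + \<i>) else 1)" for z
  have S_hol: "S holomorphic_on half_disc x0 r"
    unfolding S_def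
  proof (rule cayley_extension_holomorphic[OF open_half_disc])
    show "w meromorphic_on half_disc x0 r"
      using w meromorphic_on_subset[OF _ half_disc_subset] by (simp add: nicely_meromorphic_on_def)
    show "w analytic_on {z} \<or> is_pole w z" if "z \<in> half_disc x0 r" for z
      using analytic_or_pole[OF w] that half_disc_subset by blast
    show "w z \<noteq> - \<i>" if "z \<in> half_disc x0 r" "w analytic_on {z}" for z
      using ne[OF that(1)] \<rho>_iff[OF that(1)] that(2) by blast
  qed
  have S_eq: "S z = (w z - \<i>) / (w z + \<i>)" "1 - (cmod (S z))\<^sup>2 = 4 * Im (w z) / (cmod (w z + \<i>))\<^sup>2"
      "w z + \<i> \<noteq> 0"
    if "z \<in> half_disc x0 r" "z \<in> \<rho>" for z
  proof -
    show 1: "S z = (w z - \<i>) / (w z + \<i>)" using that \<rho>_iff by (simp add: S_def)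
    show "1 - (cmod (S z))\<^sup>2 = 4 * Im (w z) / (cmod (w z + \<i>))\<^sup>2"
      unfolding 1 by (rule cayley_norm[OF ne[OF that]])
    show "w z + \<i> \<noteq> 0" using ne[OF that] by (simp add: add_eq_0_iff2)
  qed
  have S_bound: "(cmod (S z))\<^sup>2 \<le> 1 + 8 * C * Im z" if z: "z \<in> half_disc x0 r" for z
  proof (cases "z \<in> \<rho>")
    case True
    define N v t where "N = 1 + (cmod (w z))\<^sup>2" and "v = Im (w z)" and "t = C * Im z"
    have t: "0 \<le> t" "4 * t \<le> 1" using Cy[OF z] by (simp_all add: t_def)
    have N: "N > 0" by (simp add: N_def add_pos_nonneg)
    have v: "- t * N \<le> v" using C(2)[of z] True by (simp add: N_def v_def t_def \<rho>_def)
    have den: "(cmod (w z + \<i>))\<^sup>2 = N + 2 * v"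
      unfolding cmod_power2 N_def v_def by (simp add: power2_eq_square algebra_simps)
    have den_pos: "(cmod (w z + \<i>))\<^sup>2 > 0" using S_eq(3)[OF z True] by simp
    \<comment> \<open>This product and the next one add up to (16 t + 4) v + 8 t N, whose
      nonnegativity is the inequality -4 v <= 8 t (N + 2 v).\<close>
    have "0 \<le> (16 * t + 4) * (v + t * N)" by (rule mult_nonneg_nonneg) (use t v in auto)
    moreover have "0 \<le> 4 * t * N * (1 - 4 * t)" using t N by (intro mult_nonneg_nonneg) auto
    ultimately have "- (4 * v) \<le> 8 * t * (N + 2 * v)" by (simp add: algebra_simps)
    moreover have "N + 2 * v > 0" using den_pos by (simp only: den)
    ultimately have "- (4 * v) / (N + 2 * v) \<le> 8 * t" by (simp only: pos_divide_le_eq)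
    moreover have "1 - (cmod (S z))\<^sup>2 = 4 * v / (N + 2 * v)"
      using S_eq(2)[OF z True] by (simp only: den v_def)
    ultimately have "(cmod (S z))\<^sup>2 \<le> 1 + 8 * t" unfolding minus_divide_left[symmetric] by linarith
    then show ?thesis by (simp add: t_def)
  next
    case False
    then show ?thesis using Cy[OF z] \<rho>_iff[OF z] by (simp add: S_def)
  qed
  \<comment> \<open>|E|^2 = exp(-8 C Im z) offsets the excess 1 + 8 C Im z allowed by
    \<open>S_bound\<close>. Since \<open>E\<close> tends to 1 at \<open>x0\<close>, \<open>T\<close>
    and \<open>S\<close> have the same boundary value there.\<close>
  define E where "E z = exp (\<i> * of_real (4 * C) * (z - of_real x0))" for z
  have E_norm: "(cmod (E z))\<^sup>2 = exp (- (8 * C * Im z))" for z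
    by (simp add: E_def power2_eq_square flip: exp_add)
  define T where "T z = S z * E z" for z
  have T_sq: "(cmod (T z))\<^sup>2 = (cmod (S z))\<^sup>2 * exp (- (8 * C * Im z))" for z
    by (simp add: T_def norm_mult power_mult_distrib E_norm)
  have T_hol: "T holomorphic_on half_disc x0 r"
    unfolding T_def E_def by (intro holomorphic_intros S_hol)
  have T_le: "cmod (T z) \<le> 1" if z: "z \<in> half_disc x0 r" for z
  proof -
    have "(cmod (S z))\<^sup>2 \<le> exp (8 * C * Im z)"
      using S_bound[OF z] exp_ge_add_one_self[of "8 * C * Im z"] by linarith
    then have "(cmod (T z))\<^sup>2 \<le> exp (8 * C * Im z) * exp (- (8 * C * Im z))"
      unfolding T_sq by (intro mult_right_mono) auto
    then have "(cmod (T z))\<^sup>2 \<le> 1" by (simp flip: exp_add)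
    then show ?thesis by (simp add: abs_square_le_1)
  qed
  let ?G = "at (complex_of_real x0) within (\<rho> \<inter> nontangential_sector x0 1)"
  have G: "?G \<noteq> bot" using nt_filter_nontrivial[OF w, of 1] by (simp add: \<rho>_def)
  have w_lim: "(w \<longlongrightarrow> of_real w0) ?G" using w0 by (simp add: nt_limit_def \<rho>_def)
  have id_lim: "((\<lambda>s. s) \<longlongrightarrow> of_real x0) ?G" by (rule tendsto_ident_at)
  have k_lim: "((\<lambda>s. Im (w s) / Im s) \<longlongrightarrow> dt) ?G"
  proof -
    have "((\<lambda>s. Re (nevanlinna_kernel w s s)) \<longlongrightarrow> Re (of_real dt)) ?G"
      using dt by (intro tendsto_Re) (simp add: nt_limit_def \<rho>_def)
    moreover have "eventually (\<lambda>s. Re (nevanlinna_kernel w s s) = Im (w s) / Im s) ?G"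
      unfolding eventually_at_filter
      by (rule always_eventually) (auto dest: \<rho>_pos simp: nevanlinna_kernel_diagonal)
    ultimately show ?thesis by (simp add: Lim_transform_eventually)
  qed
  have G_disc: "eventually (\<lambda>s. s \<in> \<rho> \<and> s \<in> half_disc x0 (r / 2)) ?G"
    unfolding eventually_at using r \<rho>_pos
    by (intro exI[of _ "r / 2"]) (auto simp: half_disc_def dist_norm)
  have disc_sub: "half_disc x0 (r / 2) \<subseteq> half_disc x0 r" using r by (auto simp: half_disc_def)
  have w0i: "of_real w0 + \<i> \<noteq> 0" by (simp add: complex_eq_iff)
  define T0 where "T0 = (of_real w0 - \<i>) / (of_real w0 + \<i>)"
  have T0_norm: "cmod T0 = 1"
  proof -
    have "1 - (cmod T0)\<^sup>2 = 0"
      unfolding T0_def by (subst cayley_norm) (simp_all add: complex_eq_iff)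
    then have "cmod T0 = 1 \<or> cmod T0 = - 1" by (simp add: power2_eq_1_iff)
    then show ?thesis using norm_ge_zero[of T0] by linarith
  qed
  have T_lim: "(T \<longlongrightarrow> T0) ?G"
  proof -
    have "((\<lambda>s. (w s - \<i>) / (w s + \<i>) * E s) \<longlongrightarrow>
        T0 * exp (\<i> * of_real (4 * C) * (of_real x0 - of_real x0))) ?G"
      unfolding T0_def E_def by (intro tendsto_intros w_lim id_lim w0i)
    moreover have "eventually (\<lambda>s. (w s - \<i>) / (w s + \<i>) * E s = T s) ?G"
      using G_disc by eventually_elim (use disc_sub S_eq(1) in \<open>auto simp: T_def\<close>)
    ultimately show ?thesis by (simp add: Lim_transform_eventually)
  qed
  \<comment> \<open>Limit of an upper bound for (1 - |T s|^2) / Im s: the first term is the defect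
    of the Cayley transform, and 24 C is 3 times 8 C, from the exponential and |S s|^2 <= 3.\<close>
  define A where "A = 4 * dt / (cmod (of_real w0 + \<i>))\<^sup>2 + 24 * C"
  have julia: "Im z * (cmod (1 - T z * cnj T0))\<^sup>2 \<le> (cmod (z - cnj (of_real x0)))\<^sup>2 * ((1 - (cmod (T z))\<^sup>2) * A)"
    if z: "z \<in> half_disc x0 (r / 2)" for z
  proof (rule tendsto_le[OF G])
    show "((\<lambda>s. Im z * (cmod (1 - T z * cnj (T s)))\<^sup>2) \<longlongrightarrow> Im z * (cmod (1 - T z * cnj T0))\<^sup>2) ?G"
      by (intro tendsto_intros T_lim)
    show "((\<lambda>s. (cmod (z - cnj s))\<^sup>2 * ((1 - (cmod (T z))\<^sup>2) *
        (4 * (Im (w s) / Im s) / (cmod (w s + \<i>))\<^sup>2 + 24 * C))) \<longlongrightarrow>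
        (cmod (z - cnj (of_real x0)))\<^sup>2 * ((1 - (cmod (T z))\<^sup>2) * A)) ?G"
      unfolding A_def by (intro tendsto_intros id_lim k_lim w_lim) (use w0i in simp)
    show "\<forall>\<^sub>F s in ?G. Im z * (cmod (1 - T z * cnj (T s)))\<^sup>2 \<le> (cmod (z - cnj s))\<^sup>2 *
        ((1 - (cmod (T z))\<^sup>2) * (4 * (Im (w s) / Im s) / (cmod (w s + \<i>))\<^sup>2 + 24 * C))"
      using G_disc
    proof eventually_elim
      case (elim s)
      then have s: "s \<in> half_disc x0 r" "s \<in> \<rho>" using disc_sub by auto
      note y = Cy(3)[OF s(1)]
      have S3: "(cmod (S s))\<^sup>2 \<le> 3" using S_bound[OF s(1)] Cy(1)[OF s(1)] by simp
      have "1 - 8 * C * Im s \<le> exp (- (8 * C * Im s))"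
        using exp_ge_add_one_self[of "- (8 * C * Im s)"] by simp
      then have "(cmod (S s))\<^sup>2 * (1 - 8 * C * Im s) \<le> (cmod (T s))\<^sup>2"
        unfolding T_sq by (intro mult_left_mono) auto
      then have "1 - (cmod (T s))\<^sup>2 \<le> 1 - (cmod (S s))\<^sup>2 + (cmod (S s))\<^sup>2 * (8 * C * Im s)"
        by (simp add: algebra_simps)
      also have "(cmod (S s))\<^sup>2 * (8 * C * Im s) \<le> 3 * (8 * C * Im s)"
        using S3 Cy(2)[OF s(1)] by (intro mult_right_mono) auto
      also have "1 - (cmod (S s))\<^sup>2 + 3 * (8 * C * Im s) =
          Im s * (4 * (Im (w s) / Im s) / (cmod (w s + \<i>))\<^sup>2 + 24 * C)"
        using y unfolding S_eq(2)[OF s] by (simp add: distrib_left)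
      finally have Ts: "1 - (cmod (T s))\<^sup>2 \<le>
          Im s * (4 * (Im (w s) / Im s) / (cmod (w s + \<i>))\<^sup>2 + 24 * C)" by simp
      have Tz: "1 - (cmod (T z))\<^sup>2 \<ge> 0" using T_le[of z] z disc_sub by (auto simp: abs_square_le_1)
      have "Im s * (Im z * (cmod (1 - T z * cnj (T s)))\<^sup>2) \<le>
          (cmod (z - cnj s))\<^sup>2 * ((1 - (cmod (T z))\<^sup>2) * (1 - (cmod (T s))\<^sup>2))"
        using schwarz_pick_half_disc[OF r T_hol T_le z, of s] elim by (simp add: mult_ac)
      also have "\<dots> \<le> (cmod (z - cnj s))\<^sup>2 * ((1 - (cmod (T z))\<^sup>2) *
          (Im s * (4 * (Im (w s) / Im s) / (cmod (w s + \<i>))\<^sup>2 + 24 * C)))"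
        using Ts Tz by (intro mult_left_mono) auto
      also have "\<dots> = Im s * ((cmod (z - cnj s))\<^sup>2 * ((1 - (cmod (T z))\<^sup>2) *
          (4 * (Im (w s) / Im s) / (cmod (w s + \<i>))\<^sup>2 + 24 * C)))"
        by (simp only: mult_ac)
      finally show ?case using y by (simp only: mult_le_cancel_left_pos)
    qed
  qed
  \<comment> \<open>Distance of the boundary value \<open>T0\<close> from 1, the image of infinity;
    it is positive because \<open>w0\<close> is finite.\<close>
  define \<eta> where "\<eta> = cmod (T0 - 1)"
  have \<eta>: "\<eta> > 0"
  proof -
    have "T0 \<noteq> 1"
    proof
      assume "T0 = 1"
      then have "of_real w0 - \<i> = of_real w0 + \<i>" using w0i by (simp only: T0_def divide_eq_1_iff)
      then show False by (simp add: complex_eq_iff)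
    qed
    then show ?thesis by (simp add: \<eta>_def)
  qed
  then have \<eta>4: "0 < \<eta> / 4" by simp
  \<comment> \<open>Where Im w <= 0, the defect 1 - |T z|^2 is at most 8 C Im z, and Julia's
    inequality then bounds |T0 - T z| by \<open>M\<close> times |z - x0|.\<close>
  define M where "M = sqrt (8 * C * \<bar>A\<bar>)"
  \<comment> \<open>Comes from |S z - 1| = 2 / |w z + i| and the lower bound
    \<open>\<eta> / 2\<close> for it: |w z + i| <= 4 / \<open>\<eta>\<close>.\<close>
  define W where "W = 4 / \<eta> + 1"
  have E_lim: "((\<lambda>z. cmod (E z - 1)) \<longlongrightarrow> 0) (at (complex_of_real x0) within \<rho>)"
  proof -
    have "((\<lambda>z. cmod (E z - 1)) \<longlongrightarrow>
        cmod (exp (\<i> * of_real (4 * C) * (of_real x0 - of_real x0)) - 1)) (at (complex_of_real x0) within \<rho>)"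
      unfolding E_def by (intro tendsto_intros)
    then show ?thesis by simp
  qed
  have M_lim: "((\<lambda>z. M * cmod (z - of_real x0)) \<longlongrightarrow> 0) (at (complex_of_real x0) within \<rho>)"
  proof -
    have "((\<lambda>z. M * cmod (z - of_real x0)) \<longlongrightarrow> M * cmod (of_real x0 - of_real x0 :: complex))
        (at (complex_of_real x0) within \<rho>)" by (intro tendsto_intros)
    then show ?thesis by simp
  qed
  have disc_ev: "eventually (\<lambda>z. z \<in> \<rho> \<and> z \<in> half_disc x0 (r / 2)) (at (complex_of_real x0) within \<rho>)"
    unfolding eventually_at using r \<rho>_pos
    by (intro exI[of _ "r / 2"]) (auto simp: half_disc_def dist_norm)
  have "eventually (\<lambda>z. - (C * (1 + W\<^sup>2)) \<le> Im (w z) / Im z) (at (complex_of_real x0) within \<rho>)"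
    using disc_ev order_tendstoD(2)[OF E_lim \<eta>4] order_tendstoD(2)[OF M_lim \<eta>4]
  proof eventually_elim
    case (elim z)
    then have z: "z \<in> half_disc x0 r" "z \<in> \<rho>" "z \<in> half_disc x0 (r / 2)"
      and E1: "cmod (E z - 1) < \<eta> / 4" and M1: "M * cmod (z - of_real x0) < \<eta> / 4"
      using disc_sub by auto
    note y = Cy(3)[OF z(1)]
    show ?case
    proof (cases "Im (w z) \<ge> 0")
      case True
      then have "0 \<le> Im (w z) / Im z" using y by simp
      moreover have "0 \<le> C * (1 + W\<^sup>2)" using C(1) by simp
      ultimately show ?thesis by linarith
    next
      case False
      then have "1 - (cmod (S z))\<^sup>2 \<le> 0"
        unfolding S_eq(2)[OF z(1,2)] by (simp add: divide_nonpos_nonneg)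
      then have "1 * exp (- (8 * C * Im z)) \<le> (cmod (T z))\<^sup>2"
        unfolding T_sq by (intro mult_right_mono) auto
      then have T1: "1 - (cmod (T z))\<^sup>2 \<le> 8 * C * Im z"
        using exp_ge_add_one_self[of "- (8 * C * Im z)"] by simp
      have T2: "0 \<le> 1 - (cmod (T z))\<^sup>2" using T_le[OF z(1)] by (simp add: abs_square_le_1)
      have "(1 - (cmod (T z))\<^sup>2) * A \<le> (1 - (cmod (T z))\<^sup>2) * \<bar>A\<bar>"
        by (rule mult_left_mono[OF abs_ge_self T2])
      also have "\<dots> \<le> (8 * C * Im z) * \<bar>A\<bar>" by (rule mult_right_mono[OF T1 abs_ge_zero])
      finally have "(cmod (z - cnj (of_real x0)))\<^sup>2 * ((1 - (cmod (T z))\<^sup>2) * A) \<le>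
          (cmod (z - cnj (of_real x0)))\<^sup>2 * ((8 * C * Im z) * \<bar>A\<bar>)"
        by (rule mult_left_mono) simp
      with julia[OF z(3)] have "Im z * (cmod (1 - T z * cnj T0))\<^sup>2 \<le>
          Im z * (8 * C * \<bar>A\<bar> * (cmod (z - of_real x0))\<^sup>2)" by (simp add: mult_ac)
      then have "(cmod (1 - T z * cnj T0))\<^sup>2 \<le> 8 * C * \<bar>A\<bar> * (cmod (z - of_real x0))\<^sup>2"
        using y by (simp only: mult_le_cancel_left_pos)
      then have "cmod (1 - T z * cnj T0) \<le> sqrt (8 * C * \<bar>A\<bar> * (cmod (z - of_real x0))\<^sup>2)"
        by (rule real_le_rsqrt)
      then have JT: "cmod (1 - T z * cnj T0) \<le> M * cmod (z - of_real x0)"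
        by (simp add: M_def real_sqrt_mult)
      have "T0 * cnj T0 = 1" using T0_norm complex_norm_square[of T0] by simp
      then have "T0 - T z = T0 * (1 - T z * cnj T0)" by (simp add: algebra_simps)
      then have "cmod (T0 - T z) = cmod (1 - T z * cnj T0)" by (simp add: norm_mult T0_norm)
      then have T0T: "cmod (T0 - T z) < \<eta> / 4" using JT M1 by linarith
      \<comment> \<open>The outer two pieces are smaller than \<open>\<eta> / 4\<close>, so the
        middle one, of modulus |S z - 1| |E z|, is at least \<open>\<eta> / 2\<close>.\<close>
      have "T0 - 1 = (T0 - T z) + (T z - E z) + (E z - 1)" by simp
      then have "\<eta> \<le> cmod (T0 - T z) + cmod (T z - E z) + cmod (E z - 1)"
        unfolding \<eta>_def by (metis norm_triangle_le norm_triangle_ineq add_right_mono)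
      then have TE: "\<eta> / 2 \<le> cmod (T z - E z)" using T0T E1 by linarith
      have "cmod (E z) \<le> 1"
      proof -
        have "(cmod (E z))\<^sup>2 \<le> 1" unfolding E_norm using Cy(2)[OF z(1)] by simp
        then show ?thesis by (simp add: abs_square_le_1)
      qed
      then have "cmod (S z - 1) * cmod (E z) \<le> cmod (S z - 1)" by (simp add: mult_left_le)
      moreover have "T z - E z = (S z - 1) * E z" by (simp add: T_def algebra_simps)
      then have "cmod (T z - E z) = cmod (S z - 1) * cmod (E z)" by (simp only: norm_mult)
      ultimately have S1: "\<eta> / 2 \<le> cmod (S z - 1)" using TE by linarith
      have "S z - 1 = - 2 * \<i> / (w z + \<i>)"
        using S_eq(1,3)[OF z(1,2)] by (simp add: field_simps)
      then have "cmod (S z - 1) = 2 / cmod (w z + \<i>)" by (simp add: norm_mult norm_divide)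
      moreover have "cmod (w z + \<i>) > 0" using S_eq(3)[OF z(1,2)] by simp
      ultimately have "cmod (w z + \<i>) \<le> 4 / \<eta>" using S1 \<eta> by (simp add: field_simps)
      then have "cmod (w z) \<le> W" using norm_triangle_ineq4[of "w z + \<i>" \<i>] by (simp add: W_def)
      then have "(cmod (w z))\<^sup>2 \<le> W\<^sup>2" by (intro power_mono) auto
      then have "C * Im z * (1 + (cmod (w z))\<^sup>2) \<le> C * Im z * (1 + W\<^sup>2)"
        using Cy(2)[OF z(1)] by (intro mult_left_mono) auto
      then have "- (C * (1 + W\<^sup>2)) * Im z \<le> Im (w z)"
        using C(2)[of z] z(2) by (simp add: \<rho>_def mult_ac)
      then show ?thesis using y by (simp add: pos_le_divide_eq)
    qed
  qed
  then show ?thesis using that unfolding \<rho>_def by blast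
qed

text \<open>Passing to a finer filter can only raise a lower limit, and along the sector, where the
  filter is nontrivial, the lower limit is the limit.\<close>

lemma Liminf_le_nt_limit:
  fixes f :: "complex \<Rightarrow> real"
  assumes w: "w nicely_meromorphic_on upper_half_plane"
    and L: "(f \<longlongrightarrow> L) (at (complex_of_real x0) within (analyticity_domain w \<inter> nontangential_sector x0 1))"
  shows "Liminf (at (complex_of_real x0) within analyticity_domain w) (\<lambda>z. ereal (f z)) \<le> ereal L"
proof -
  let ?G = "at (complex_of_real x0) within (analyticity_domain w \<inter> nontangential_sector x0 1)"
  have "?G \<le> at (complex_of_real x0) within analyticity_domain w" by (rule at_le) auto
  then have "Liminf (at (complex_of_real x0) within analyticity_domain w) (\<lambda>z. ereal (f z)) \<le>
      Liminf ?G (\<lambda>z. ereal (f z))"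
    unfolding Liminf_def le_filter_def by (intro SUP_subset_mono) auto
  also have "\<dots> = ereal L"
    using L by (intro lim_imp_Liminf nt_filter_nontrivial[OF w]) auto
  finally show ?thesis .
qed

text \<open>The difference quotient is the hub. Its limit yields the boundary value, the limit of
  the kernel and that of the derivative, and it is itself obtained from the lower limit of the
  kernel or from the derivative. From the limit of the kernel the way leads through the lower
  limit.\<close>

theorem theorem1p6:
  fixes \<kappa> :: nat and w :: "complex \<Rightarrow> complex" and x0 :: real
  assumes "w \<in> generalized_nevanlinna \<kappa>"
  shows
    "((modulus_liminf w x0 < \<infinity> \<and> - \<infinity> < kernel_liminf w x0 \<and> kernel_liminf w x0 < \<infinity>)
        \<longleftrightarrow> (\<exists>w0 dt. nt_limit w x0 w w0 \<and> nt_limit w x0 (\<lambda>z. nevanlinna_kernel w z z) dt)) \<and>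
     ((\<exists>w0 dt. nt_limit w x0 w w0 \<and> nt_limit w x0 (\<lambda>z. nevanlinna_kernel w z z) dt)
        \<longleftrightarrow> (\<exists>w0 w1. nt_limit w x0 w w0 \<and> nt_limit w x0 (deriv w) w1)) \<and>
     ((\<exists>w0 w1. nt_limit w x0 w w0 \<and> nt_limit w x0 (deriv w) w1)
        \<longleftrightarrow> (\<exists>w0 wt1. nt_limit w x0 w w0 \<and>
              nt_limit w x0 (\<lambda>z. (w z - of_real w0) / (z - of_real x0)) wt1)) \<and>
     (\<forall>w0 dt w1 wt1.
        modulus_liminf w x0 < \<infinity> \<and> - \<infinity> < kernel_liminf w x0 \<and> kernel_liminf w x0 < \<infinity> \<and>
        nt_limit w x0 w w0 \<and>
        nt_limit w x0 (\<lambda>z. nevanlinna_kernel w z z) dt \<and>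
        nt_limit w x0 (deriv w) w1 \<and>
        nt_limit w x0 (\<lambda>z. (w z - of_real w0) / (z - of_real x0)) wt1
        \<longrightarrow> kernel_liminf w x0 = ereal dt \<and> dt = w1 \<and> w1 = wt1)"
proof -
  let ?q = "\<lambda>w0 z. (w z - of_real w0) / (z - of_real x0)"
  let ?K = "\<lambda>z. nevanlinna_kernel w z z"
  have w: "w nicely_meromorphic_on upper_half_plane"
    using assms by (simp add: generalized_nevanlinna_def)
  obtain C where C: "C \<ge> 0"
    "\<And>z. z \<in> analyticity_domain w \<Longrightarrow> - C * Im z * (1 + (cmod (w z))\<^sup>2) \<le> Im (w z)"
    using generalized_nevanlinna_kernel_lower_bound[OF assms] by blast
  note quot = nt_limit_value_of_quotient nt_kernel_limit_of_quotient nt_deriv_limit_of_quotient[OF w]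
  \<comment> \<open>The digits name the implication, here from the first statement to the fourth;
    likewise for \<open>21\<close> and \<open>34\<close>.\<close>
  have 14: "\<exists>w0 d. kernel_liminf w x0 = ereal d \<and> nt_limit w x0 (?q w0) d"
    if fin: "- \<infinity> < kernel_liminf w x0" "kernel_liminf w x0 < \<infinity>"
  proof -
    obtain d where d: "kernel_liminf w x0 = ereal d" using fin by (cases "kernel_liminf w x0") auto
    then show ?thesis using nt_quotient_limit_of_kernel_liminf[OF w d] by metis
  qed
  have 21: "modulus_liminf w x0 < \<infinity> \<and> - \<infinity> < kernel_liminf w x0 \<and> kernel_liminf w x0 < \<infinity>"
    if w0: "nt_limit w x0 w w0" and dt: "nt_limit w x0 ?K dt" for w0 dt
  proof (intro conjI)
    have "((\<lambda>z. cmod (w z)) \<longlongrightarrow> cmod (of_real w0))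
        (at (complex_of_real x0) within (analyticity_domain w \<inter> nontangential_sector x0 1))"
      using w0 by (intro tendsto_norm) (simp add: nt_limit_def)
    from Liminf_le_nt_limit[OF w this] show "modulus_liminf w x0 < \<infinity>"
      unfolding modulus_liminf_def by (rule le_less_trans) simp
    have "((\<lambda>z. Re (?K z)) \<longlongrightarrow> Re (of_real dt))
        (at (complex_of_real x0) within (analyticity_domain w \<inter> nontangential_sector x0 1))"
      using dt by (intro tendsto_Re) (simp add: nt_limit_def)
    from Liminf_le_nt_limit[OF w this] show "kernel_liminf w x0 < \<infinity>"
      unfolding kernel_liminf_def by (rule le_less_trans) simp
    obtain M where "\<forall>\<^sub>F z in at (complex_of_real x0) within analyticity_domain w. M \<le> Im (w z) / Im z"
      using kernel_bounded_below_of_nt_limits[OF w C w0 dt] .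
    then have "ereal M \<le> kernel_liminf w x0"
      unfolding kernel_liminf_eq by (intro Liminf_bounded) simp
    then show "- \<infinity> < kernel_liminf w x0" by (rule less_le_trans[rotated]) simp
  qed
  have 34: "\<exists>w0 d. nt_limit w x0 w w0 \<and> nt_limit w x0 (?q w0) d"
    if "nt_limit w x0 w w0" "nt_limit w x0 (deriv w) d" for w0 d
    using nt_quotient_limit_of_deriv[OF w that] that by blast
  have "kernel_liminf w x0 = ereal dt \<and> dt = w1 \<and> w1 = wt1"
    if fin: "- \<infinity> < kernel_liminf w x0" "kernel_liminf w x0 < \<infinity>"
      and lims: "nt_limit w x0 w w0" "nt_limit w x0 ?K dt" "nt_limit w x0 (deriv w) w1" "nt_limit w x0 (?q w0) wt1"
    for w0 dt w1 wt1
  proof -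
    obtain w0' d where d: "kernel_liminf w x0 = ereal d" "nt_limit w x0 (?q w0') d" using 14[OF fin] by blast
    note uniq = nt_limit_unique[OF w]
    have "dt = d" "w1 = d" using uniq lims quot(2,3)[OF d(2)] by blast+
    \<comment> \<open>The quotient depends on the boundary value, so \<open>w0'\<close> is
      identified with \<open>w0\<close> before the limits of the two quotients are compared.\<close>
    moreover have "w0' = w0" using uniq lims(1) quot(1)[OF d(2)] by blast
    then have "wt1 = d" using uniq lims(4) d(2) by blast
    ultimately show ?thesis using d(1) by simp
  qed
  then show ?thesis using 14 21 34 quot by (intro conjI) meson+
qed

end
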